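(* Let $\mathcal{H}$ be a reproducing kernel Hilbert space on a nonempty set $\Omega$, let $n$ be a positive integer, and let $A=[A_{ij}]$ be an $n\times n$ operator matrix acting on $\mathcal{H}\oplus\cdots\oplus\mathcal{H}$ ($n$ copies), where $A_{ij}\in\mathbb{B}(\mathcal{H})$ for all $i,j=1,\dots,n$. Let $f,g:[0,\infty)\to[0,\infty)$ be continuous functions satisfying $f(\lambda)g(\lambda)=\lambda$ for all $\lambda\in[0,\infty)$. Then $$\mathbf{ber}(A)\le w(\hat A),$$ where $\hat A=[a_{ij}]$ is the upper triangular complex $n\times n$ matrix with $a_{ii}=\mathbf{ber}(A_{ii})$, $a_{ij}=0$ for $i>j$, and for $i<j$ $$a_{ij}=\big\|f^2(|A_{ij}|)+g^2(|A_{ji}^*|)\big\|_{ber}^{1/2}\,\big\|f^2(|A_{ji}|)+g^2(|A_{ij}^*|)\big\|_{ber}^{1/2}.$$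
   Context: A reproducing kernel Hilbert space (RKHS) $\mathcal{H}$ on a nonempty set $\Omega$ is a complex Hilbert space of complex-valued functions on $\Omega$ for which every evaluation $f\mapsto f(\lambda)$, $\lambda\in\Omega$, is a bounded linear functional; $k_\lambda\in\mathcal{H}$ is the unique element with $f(\lambda)=\langle f,k_\lambda\rangle$ for all $f\in\mathcal{H}$, it is assumed that $k_\lambda\neq0$, and $\hat k_\lambda=k_\lambda/\|k_\lambda\|$. $\mathbb{B}(\mathcal{H})$ is the algebra of bounded linear operators on $\mathcal{H}$. For $T\in\mathbb{B}(\mathcal{H})$, the Berezin number is $\mathbf{ber}(T)=\sup_{\lambda\in\Omega}|\langle T\hat k_\lambda,\hat k_\lambda\rangle|$ and the Berezin norm is $\|T\|_{ber}=\sup_{\lambda,\mu\in\Omega}|\langle T\hat k_\lambda,\hat k_\mu\rangle|$. The direct sum of $n$ copies of $\mathcal{H}$ is treated as an RKHS on $\Omega^n$ whose kernel at $(\lambda_1,\dots,\lambda_n)$ is the vector $(k_{\lambda_1},\dots,k_{\lambda_n})$, with normalization $\hat k_{(\lambda_1,\dots,\lambda_n)}=(k_{\lambda_1},\dots,k_{\lambda_n})/\big(\sum_i\|k_{\lambda_i}\|^2\big)^{1/2}$; thus for an operator $A$ on the direct sum, $\mathbf{ber}(A)=\sup|\langle A\hat k_{(\lambda_1,\dots,\lambda_n)},\hat k_{(\lambda_1,\dots,\lambda_n)}\rangle|$ over $(\lambda_1,\dots,\lambda_n)\in\Omega^n$. The operator matrix $A=[A_{ij}]$ acts by $(Ax)_i=\sum_jA_{ij}x_j$.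 $|T|=(T^*T)^{1/2}$, and $f^2(|T|)=f(|T|)^2$ is defined by the continuous functional calculus. For a complex $n\times n$ matrix $M$, $w(M)=\sup\{|\langle Mx,x\rangle|:x\in\mathbb{C}^n,\|x\|=1\}$ is the numerical radius. *)

theory Defs
  imports "HOL-Analysis.Analysis" "HOL-Computational_Algebra.Polynomial"
begin

text \<open>
  Complex Hilbert spaces. The inner product is linear in its first argument; positive
  definiteness is contained in \<open>cinner_same\<close>, and the remaining vector space axioms
  for \<open>scaleC\<close> follow from \<open>scaleC_of_real\<close>.
\<close>

class complex_hilbert = banach +
  fixes scaleC :: "complex \<Rightarrow> 'a \<Rightarrow> 'a"  (infixr "*\<^sub>C" 75)
    and cinner :: "'a \<Rightarrow> 'a \<Rightarrow> complex"
  assumes scaleC_add_right: "c *\<^sub>C (x + y) = c *\<^sub>C x + c *\<^sub>C y"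
    and scaleC_add_left: "(c + d) *\<^sub>C x = c *\<^sub>C x + d *\<^sub>C x"
    and scaleC_scaleC: "c *\<^sub>C d *\<^sub>C x = (c * d) *\<^sub>C x"
    and scaleC_of_real: "complex_of_real r *\<^sub>C x = r *\<^sub>R x"
    and cinner_add_left: "cinner (x + y) z = cinner x z + cinner y z"
    and cinner_scaleC_left: "cinner (c *\<^sub>C x) y = c * cinner x y"
    and cinner_commute: "cinner x y = cnj (cinner y x)"
    and cinner_same: "cinner x x = complex_of_real ((norm x)\<^sup>2)"

instantiation complex :: complex_hilbert
begin

definition scaleC_complex :: "complex \<Rightarrow> complex \<Rightarrow> complex"
  where "scaleC_complex c x = c * x"

definition cinner_complex :: "complex \<Rightarrow> complex \<Rightarrow> complex"
  where "cinner_complex x y = x * cnj y"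

instance
  by standard
    (simp_all only: scaleC_complex_def cinner_complex_def algebra_simps scaleR_conv_of_real
      complex_norm_square complex_cnj_mult complex_cnj_cnj)

end

text \<open>The Hilbert space direct sum of \<open>CARD('n)\<close> copies of a Hilbert space.\<close>

instantiation vec :: (complex_hilbert, finite) complex_hilbert
begin

definition scaleC_vec :: "complex \<Rightarrow> 'a ^ 'b \<Rightarrow> 'a ^ 'b"
  where "scaleC_vec c x = (\<chi> i. c *\<^sub>C x $ i)"

definition cinner_vec :: "'a ^ 'b \<Rightarrow> 'a ^ 'b \<Rightarrow> complex"
  where "cinner_vec x y = (\<Sum>i\<in>UNIV. cinner (x $ i) (y $ i))"

instance
proof
  fix x y z :: "'a ^ 'b" and c d :: complex and r :: real
  show "c *\<^sub>C (x + y) = c *\<^sub>C x + c *\<^sub>C y"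
    by (simp add: scaleC_vec_def vec_eq_iff scaleC_add_right)
  show "(c + d) *\<^sub>C x = c *\<^sub>C x + d *\<^sub>C x"
    by (simp add: scaleC_vec_def vec_eq_iff scaleC_add_left)
  show "c *\<^sub>C d *\<^sub>C x = (c * d) *\<^sub>C x"
    by (simp add: scaleC_vec_def vec_eq_iff scaleC_scaleC)
  show "complex_of_real r *\<^sub>C x = r *\<^sub>R x"
    by (simp add: scaleC_vec_def vec_eq_iff scaleC_of_real)
  show "cinner (x + y) z = cinner x z + cinner y z"
    by (simp add: cinner_vec_def cinner_add_left sum.distrib)
  show "cinner (c *\<^sub>C x) y = c * cinner x y"
    by (simp add: cinner_vec_def scaleC_vec_def cinner_scaleC_left sum_distrib_left)
  show "cinner x y = cnj (cinner y x)"
    unfolding cinner_vec_def cnj_sum by (rule sum.cong[OF refl]) (rule cinner_commute)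
  show "cinner x x = complex_of_real ((norm x)\<^sup>2)"
    by (simp add: cinner_vec_def cinner_same norm_vec_def L2_set_def sum_nonneg)
qed

end

text \<open>
  The elements of the library type \<open>'a \<Rightarrow>\<^sub>L 'a\<close> are the bounded \<^emph>\<open>real\<close>-linear operators;
  the algebra of bounded operators on the complex Hilbert space consists of those satisfying
  the following predicate.
\<close>

definition complex_linear :: "('a::complex_hilbert \<Rightarrow>\<^sub>L 'b::complex_hilbert) \<Rightarrow> bool"
  where "complex_linear T \<longleftrightarrow> (\<forall>c x. T (c *\<^sub>C x) = c *\<^sub>C T x)"

definition adj :: "('a::complex_hilbert \<Rightarrow>\<^sub>L 'a) \<Rightarrow> 'a \<Rightarrow>\<^sub>L 'a"
  where "adj T = (THE S :: 'a \<Rightarrow>\<^sub>L 'a. \<forall>x y. cinner (T x) y = cinner x (S y))"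

definition spectrum :: "('a::complex_hilbert \<Rightarrow>\<^sub>L 'a) \<Rightarrow> complex set"
  where "spectrum T = {z. \<not> (\<exists>S. complex_linear S \<and>
    (\<forall>x. S (T x - z *\<^sub>C x) = x) \<and> (\<forall>x. T (S x) - z *\<^sub>C S x = x))}"

definition op_poly :: "real poly \<Rightarrow> ('a::complex_hilbert \<Rightarrow>\<^sub>L 'a) \<Rightarrow> 'a \<Rightarrow>\<^sub>L 'a"
  where "op_poly p T = (\<Sum>i\<le>degree p. coeff p i *\<^sub>R (((o\<^sub>L) T) ^^ i) id_blinfun)"

text \<open>
  Continuous functional calculus of a self-adjoint \<open>T\<close> (whose spectrum is real) for a
  real-valued \<open>f\<close> continuous on the spectrum: the operator norm limit of \<open>p\<^sub>m(T)\<close>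
  for all sequences of real polynomials \<open>p\<^sub>m\<close> converging to \<open>f\<close> uniformly on the
  spectrum of \<open>T\<close>. It is only meaningful for such \<open>T\<close> and \<open>f\<close>.
\<close>

definition cfc :: "(real \<Rightarrow> real) \<Rightarrow> ('a::complex_hilbert \<Rightarrow>\<^sub>L 'a) \<Rightarrow> 'a \<Rightarrow>\<^sub>L 'a"
  where "cfc f T = (THE S. \<forall>p :: nat \<Rightarrow> real poly.
    uniform_limit {t. complex_of_real t \<in> spectrum T} (\<lambda>m. poly (p m)) f sequentially
      \<longrightarrow> (\<lambda>m. op_poly (p m) T) \<longlonglongrightarrow> S)"

definition op_abs :: "('a::complex_hilbert \<Rightarrow>\<^sub>L 'a) \<Rightarrow> 'a \<Rightarrow>\<^sub>L 'a"
  where "op_abs T = cfc sqrt (adj T o\<^sub>L T)"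

text \<open>
  A reproducing kernel Hilbert space on the nonempty set \<open>\<Omega>\<close>, the universe of the type
  \<open>'w\<close>. The type \<open>'h\<close> is identified with a space of functions on \<open>\<Omega>\<close> by the
  injective linear map \<open>ev\<close>.
\<close>

definition repr_kernel :: "('h::complex_hilbert \<Rightarrow> 'w \<Rightarrow> complex) \<Rightarrow> 'w \<Rightarrow> 'h"
  where "repr_kernel ev \<omega> = (THE k. \<forall>f. ev f \<omega> = cinner f k)"

locale rkhs =
  fixes ev :: "'h::complex_hilbert \<Rightarrow> 'w \<Rightarrow> complex"
  assumes ev_inj: "inj ev"
    and ev_add: "ev (f + g) \<omega> = ev f \<omega> + ev g \<omega>"
    and ev_scaleC: "ev (c *\<^sub>C f) \<omega> = c * ev f \<omega>"
    and ev_bounded: "\<exists>C. \<forall>f. cmod (ev f \<omega>) \<le> C * norm f"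
    and kernel_nonzero: "repr_kernel ev \<omega> \<noteq> 0"

text \<open>
  The Berezin number and norm are taken with respect to a family \<open>k\<close> of nonzero vectors, so
  that they apply both to the space itself and to its direct sum, where the family consists of
  the vectors \<open>(k\<^bsub>\<lambda>\<^sub>1\<^esub>, \<dots>, k\<^bsub>\<lambda>\<^sub>n\<^esub>)\<close>.
\<close>

definition normalized :: "('w \<Rightarrow> 'h::complex_hilbert) \<Rightarrow> 'w \<Rightarrow> 'h"
  where "normalized k \<omega> = k \<omega> /\<^sub>R norm (k \<omega>)"

definition berezin_number :: "('w \<Rightarrow> 'h::complex_hilbert) \<Rightarrow> ('h \<Rightarrow>\<^sub>L 'h) \<Rightarrow> real"
  where "berezin_number k T = (SUP \<omega>. cmod (cinner (T (normalized k \<omega>)) (normalized k \<omega>)))"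

definition berezin_norm :: "('w \<Rightarrow> 'h::complex_hilbert) \<Rightarrow> ('h \<Rightarrow>\<^sub>L 'h) \<Rightarrow> real"
  where "berezin_norm k T =
    (SUP (\<omega>, \<nu>). cmod (cinner (T (normalized k \<omega>)) (normalized k \<nu>)))"

definition sum_kernel :: "('w \<Rightarrow> 'h::complex_hilbert) \<Rightarrow> 'w ^ 'n::finite \<Rightarrow> 'h ^ 'n"
  where "sum_kernel k \<omega> = (\<chi> i. k (\<omega> $ i))"

lift_definition op_matrix ::
    "('h::complex_hilbert \<Rightarrow>\<^sub>L 'h) ^ 'n ^ 'n \<Rightarrow> ('h ^ 'n::finite) \<Rightarrow>\<^sub>L ('h ^ 'n)"
  is "\<lambda>A x. \<chi> i. \<Sum>j\<in>UNIV. blinfun_apply (A $ i $ j) (x $ j)"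
proof -
  fix A :: "('h \<Rightarrow>\<^sub>L 'h) ^ 'n ^ 'n"
  let ?F = "\<lambda>x. \<chi> i. \<Sum>j\<in>UNIV. blinfun_apply (A $ i $ j) (x $ j)"
  show "bounded_linear ?F"
  proof (rule bounded_linear_intro)
    show "?F (x + y) = ?F x + ?F y" for x y
      by (simp add: vec_eq_iff blinfun.add_right sum.distrib)
    show "?F (r *\<^sub>R x) = r *\<^sub>R ?F x" for r x
      by (simp add: vec_eq_iff blinfun.scaleR_right scaleR_sum_right)
    show "norm (?F x) \<le> norm x * (\<Sum>i\<in>UNIV. \<Sum>j\<in>UNIV. norm (A $ i $ j))" for x
    proof -
      have "norm (?F x) \<le> (\<Sum>i\<in>UNIV. norm (?F x $ i))"
        unfolding norm_vec_def by (rule L2_set_le_sum) simp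
      also have "\<dots> \<le> (\<Sum>i\<in>UNIV. \<Sum>j\<in>UNIV. norm (A $ i $ j) * norm x)"
      proof (rule sum_mono)
        fix i
        have "norm (blinfun_apply (A $ i $ j) (x $ j)) \<le> norm (A $ i $ j) * norm x" for j
          by (rule order_trans[OF norm_blinfun])
            (simp add: mult_left_mono Finite_Cartesian_Product.norm_nth_le)
        then show "norm (?F x $ i) \<le> (\<Sum>j\<in>UNIV. norm (A $ i $ j) * norm x)"
          by (simp add: sum_norm_le)
      qed
      finally show ?thesis
        by (simp add: sum_distrib_left sum_distrib_right mult.commute)
    qed
  qed
qed

definition numerical_radius :: "complex ^ 'n ^ 'n::finite \<Rightarrow> real"
  where "numerical_radius M = Sup {cmod (cinner (M *v x) x) | x. norm x = 1}"

definition bound_matrix ::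
    "('h::complex_hilbert \<Rightarrow> 'w \<Rightarrow> complex) \<Rightarrow> (real \<Rightarrow> real) \<Rightarrow> (real \<Rightarrow> real)
      \<Rightarrow> ('h \<Rightarrow>\<^sub>L 'h) ^ 'n::{finite,linorder} ^ 'n::{finite,linorder} \<Rightarrow> complex ^ 'n::{finite,linorder} ^ 'n::{finite,linorder}"
  where "bound_matrix ev f g A = (\<chi> i j.
    if i = j then complex_of_real (berezin_number (repr_kernel ev) (A $ i $ i))
    else if i < j then complex_of_real
      (sqrt (berezin_norm (repr_kernel ev)
         (cfc (\<lambda>t. (f t)\<^sup>2) (op_abs (A $ i $ j)) + cfc (\<lambda>t. (g t)\<^sup>2) (op_abs (adj (A $ j $ i))))) *
       sqrt (berezin_norm (repr_kernel ev)
         (cfc (\<lambda>t. (f t)\<^sup>2) (op_abs (A $ j $ i)) + cfc (\<lambda>t. (g t)\<^sup>2) (op_abs (adj (A $ i $ j))))))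
    else 0)"

end

theory Submission
  imports Defs "HOL-Computational_Algebra.Fundamental_Theorem_Algebra"
begin

text \<open>
  The mixed Schwarz inequality
  \<open>|\<langle>T x, y\<rangle>|\<^sup>2 \<le> \<langle>f\<^sup>2(|T|) x, x\<rangle> \<langle>g\<^sup>2(|T\<^sup>*|) y, y\<rangle>\<close> bounds the entries of the quadratic form
  of \<open>A\<close> at a normalized kernel vector \<open>x = (x\<^sub>1, \<dots>, x\<^sub>n)\<close>. For \<open>i < j\<close> the Cauchy--Schwarz inequality
  in \<open>\<real>\<^sup>2\<close> merges the bounds for \<open>\<langle>A\<^sub>i\<^sub>j x\<^sub>j, x\<^sub>i\<rangle>\<close> and \<open>\<langle>A\<^sub>j\<^sub>i x\<^sub>i, x\<^sub>j\<rangle>\<close> into \<open>a\<^sub>i\<^sub>j \<parallel>x\<^sub>i\<parallel> \<parallel>x\<^sub>j\<parallel>\<close>, so the form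
  is at most the value of the form of the bound matrix at the real unit vector
  \<open>(\<parallel>x\<^sub>1\<parallel>, \<dots>, \<parallel>x\<^sub>n\<parallel>)\<close>.

  The mixed Schwarz inequality is obtained without the polar decomposition: \<open>T p(|T|) = p(|T\<^sup>*|) T\<close> for
  polynomials \<open>p\<close>, and \<open>f\<close> and \<open>1/f\<close> (after adding a small constant to \<open>f\<close>) are approximated by
  polynomials. The functional calculus rests on the spectral bound
  \<open>\<parallel>p(T)\<parallel> \<le> sup |p|\<close> over the spectrum, for self-adjoint \<open>T\<close>.
\<close>

section \<open>Complex Hilbert spaces\<close>

lemma scaleC_zero_left [simp]: "0 *\<^sub>C x = 0"
  using scaleC_of_real[of 0 x] by simp

lemma scaleC_one [simp]: "1 *\<^sub>C x = x"
  using scaleC_of_real[of 1 x] by simp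

lemma scaleC_zero_right [simp]: "c *\<^sub>C 0 = 0"
  using scaleC_add_right[of c 0 0] by simp

lemma scaleC_minus_right: "c *\<^sub>C (- x) = - (c *\<^sub>C x)"
  using scaleC_add_right[of c x "- x"] by (simp add: eq_neg_iff_add_eq_0 add.commute)

lemma scaleC_minus_left: "(- c) *\<^sub>C x = - (c *\<^sub>C x)"
  using scaleC_add_left[of c "- c" x] by (simp add: eq_neg_iff_add_eq_0 add.commute)

lemma scaleC_diff_right: "c *\<^sub>C (x - y) = c *\<^sub>C x - c *\<^sub>C y"
  using scaleC_add_right[of c x "- y"] by (simp add: scaleC_minus_right)

lemma scaleC_scaleR: "c *\<^sub>C r *\<^sub>R x = r *\<^sub>R c *\<^sub>C x"
  by (simp add: scaleC_of_real[symmetric] scaleC_scaleC mult.commute)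

lemma cinner_add_right: "cinner x (y + z) = cinner x y + cinner x z"
  using cinner_add_left[of y z x] by (metis cinner_commute complex_cnj_add)

lemma cinner_scaleC_right: "cinner x (c *\<^sub>C y) = cnj c * cinner x y"
  using cinner_scaleC_left[of c y x] by (metis cinner_commute complex_cnj_mult)

lemma cinner_scaleR_left: "cinner (r *\<^sub>R x) y = r *\<^sub>R cinner x y"
  by (metis cinner_scaleC_left scaleC_of_real scaleR_conv_of_real)

lemma cinner_scaleR_right: "cinner x (r *\<^sub>R y) = r *\<^sub>R cinner x y"
  by (metis cinner_scaleC_right scaleC_of_real scaleR_conv_of_real complex_cnj_complex_of_real)

lemma norm_scaleC: "norm (c *\<^sub>C x) = cmod c * norm x"
proof -
  have "complex_of_real ((norm (c *\<^sub>C x))\<^sup>2) = complex_of_real ((cmod c * norm x)\<^sup>2)"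
    unfolding cinner_same[symmetric] cinner_scaleC_left cinner_scaleC_right
    by (simp add: cinner_same power_mult_distrib complex_norm_square[of c, unfolded of_real_power] mult.assoc)
  then have "(norm (c *\<^sub>C x))\<^sup>2 = (cmod c * norm x)\<^sup>2"
    by (simp only: of_real_eq_iff)
  then show ?thesis
    by simp
qed

lemma bounded_linear_scaleC: "bounded_linear (\<lambda>x. c *\<^sub>C x)"
  by (rule bounded_linear_intro[where K = "cmod c"])
    (simp_all add: scaleC_add_right scaleC_scaleR norm_scaleC mult.commute)

lemma Cauchy_Schwarz_cinner: "cmod (cinner x y) \<le> norm x * norm y"
proof (cases "y = 0")
  case True
  have "cinner x 0 = 0"
    using cinner_scaleR_right[of x 0 0] by simp
  with True show ?thesis
    by simp
next
  case False
  define N where "N = (norm y)\<^sup>2"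
  define a where "a = cinner x y"
  have N: "N > 0"
    using False by (simp add: N_def)
  have yx: "cinner y x = cnj a"
    unfolding a_def by (rule cinner_commute)
  \<comment> \<open>Up to the factor \<open>N = |y|^2\<close>, the squared norm of
    \<open>N x - a y\<close> is the defect \<open>N |x|^2 - |a|^2\<close>, so its nonnegativity is
    the inequality.\<close>
  have "complex_of_real ((norm (complex_of_real N *\<^sub>C x + (- a) *\<^sub>C y))\<^sup>2)
      = complex_of_real (N * (N * (norm x)\<^sup>2 - (cmod a)\<^sup>2))"
    unfolding cinner_same[symmetric] cinner_add_left cinner_add_right cinner_scaleC_left
      cinner_scaleC_right yx a_def[symmetric]
    unfolding cinner_same N_def[symmetric]
    by (simp add: complex_norm_square[of a, unfolded of_real_power] algebra_simps)
  then have "(norm (complex_of_real N *\<^sub>C x + (- a) *\<^sub>C y))\<^sup>2 = N * (N * (norm x)\<^sup>2 - (cmod a)\<^sup>2)"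
    by (simp only: of_real_eq_iff)
  then have "0 \<le> N * (N * (norm x)\<^sup>2 - (cmod a)\<^sup>2)"
    by (metis zero_le_power2)
  then have "(cmod a)\<^sup>2 \<le> (norm x * norm y)\<^sup>2"
    using N by (simp add: zero_le_mult_iff N_def power_mult_distrib mult.commute)
  then show ?thesis
    by (simp add: a_def power2_le_iff_abs_le)
qed

lemma bounded_bilinear_cinner: "bounded_bilinear (cinner :: 'a::complex_hilbert \<Rightarrow> 'a \<Rightarrow> complex)"
proof
  show "\<exists>K. \<forall>x y :: 'a. norm (cinner x y) \<le> norm x * norm y * K"
    by (rule exI[of _ 1]) (simp add: Cauchy_Schwarz_cinner)
qed (simp_all add: cinner_add_left cinner_add_right cinner_scaleR_left cinner_scaleR_right)

interpretation cinner: bounded_bilinear "cinner :: 'a::complex_hilbert \<Rightarrow> 'a \<Rightarrow> complex"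
  by (rule bounded_bilinear_cinner)

lemma Re_cinner_same [simp]: "Re (cinner x x) = (norm x)\<^sup>2"
  by (simp add: cinner_same)

lemma Re_cinner_commute: "Re (cinner x y) = Re (cinner y x)"
  using cinner_commute[of x y] by simp

lemma abs_Re_cinner_le: "\<bar>Re (cinner x y)\<bar> \<le> norm x * norm y"
  using abs_Re_le_cmod Cauchy_Schwarz_cinner order_trans by blast

lemma norm_add_sq: "(norm (x + y))\<^sup>2 = (norm x)\<^sup>2 + 2 * Re (cinner x y) + (norm y)\<^sup>2"
  for x y :: "'a::complex_hilbert"
proof -
  have "Re (cinner (x + y) (x + y)) = (norm x)\<^sup>2 + 2 * Re (cinner x y) + (norm y)\<^sup>2"
    unfolding cinner.add_left cinner.add_right using Re_cinner_commute[of x y] by simp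
  then show ?thesis
    by simp
qed

lemma norm_diff_sq: "(norm (x - y))\<^sup>2 = (norm x)\<^sup>2 - 2 * Re (cinner x y) + (norm y)\<^sup>2"
  for x y :: "'a::complex_hilbert"
  using norm_add_sq[of x "- y"] by (simp add: cinner.minus_right)

lemma cinner_ext:
  assumes "\<And>x. cinner x u = cinner x v"
  shows "u = v"
proof -
  have "cinner (u - v) (u - v) = 0"
    using assms[of "u - v"] by (simp add: cinner.diff_right)
  then show ?thesis
    by (simp add: cinner_same)
qed

text \<open>The representing vector is the minimiser of
  \<open>J x = |x|^2 - 2 Re (\<phi> x)\<close>. Completeness supplies it as the limit of a
  minimising sequence. The vanishing first variation gives the real parts, and replacing
  \<open>x\<close> by \<open>i x\<close> the imaginary parts.\<close>

lemma Riesz_representation: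
  fixes \<phi> :: "'a::complex_hilbert \<Rightarrow> complex"
  assumes bl: "bounded_linear \<phi>" and sc: "\<And>c x. \<phi> (c *\<^sub>C x) = c * \<phi> x"
  shows "\<exists>k. \<forall>x. \<phi> x = cinner x k"
proof -
  interpret \<phi>: bounded_linear \<phi>
    by (rule bl)
  obtain M where M: "\<And>x. cmod (\<phi> x) \<le> norm x * M" and M0: "M > 0"
    using \<phi>.pos_bounded by blast
  define J where "J x = (norm x)\<^sup>2 - 2 * Re (\<phi> x)" for x
  have J_bound: "- M\<^sup>2 \<le> J x" for x
  proof -
    have "Re (\<phi> x) \<le> norm x * M"
      using M[of x] complex_Re_le_cmod[of "\<phi> x"] by linarith
    moreover have "0 \<le> (norm x - M)\<^sup>2"
      by simp
    ultimately show ?thesis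
      unfolding J_def power2_diff by linarith
  qed
  define m where "m = Inf (range J)"
  have bdd: "bdd_below (range J)"
    using J_bound by (intro bdd_belowI[of _ "- M\<^sup>2"]) auto
  have mJ: "m \<le> J x" for x
    unfolding m_def by (rule cInf_lower[OF _ bdd]) auto
  have "\<exists>x. J x < m + 1 / Suc n" for n
  proof -
    have "\<exists>y\<in>range J. y < m + 1 / Suc n"
      unfolding m_def by (rule cInf_lessD) auto
    then show ?thesis
      by blast
  qed
  then obtain X where X: "\<And>n. J (X n) < m + 1 / Suc n"
    by metis
  \<comment> \<open>The parallelogram law, in which the linear terms cancel. Since \<open>J\<close>
    is at least \<open>m\<close> at the midpoint, near-minimisers are close together.\<close>
  have par: "(norm (x - y))\<^sup>2 = 2 * J x + 2 * J y - 4 * J ((1/2) *\<^sub>R (x + y))" for x y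
  proof -
    have "4 * (norm ((1/2) *\<^sub>R (x + y)))\<^sup>2 = (norm (x + y))\<^sup>2"
      by (simp add: power_divide)
    moreover have "Re (\<phi> ((1/2) *\<^sub>R (x + y))) = (Re (\<phi> x) + Re (\<phi> y)) / 2"
      by (simp add: \<phi>.scaleR \<phi>.add)
    ultimately show ?thesis
      unfolding J_def using norm_add_sq[of x y] norm_diff_sq[of x y] by simp
  qed
  have close: "(norm (X i - X j))\<^sup>2 < 4 / Suc n" if "i \<ge> n" "j \<ge> n" for i j n
  proof -
    have "1 / Suc i \<le> 1 / Suc n" "1 / Suc j \<le> 1 / Suc n"
      using that by (simp_all add: frac_le)
    then show ?thesis
      using par[of "X i" "X j"] X[of i] X[of j] mJ[of "(1/2) *\<^sub>R (X i + X j)"] by simp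
  qed
  have "Cauchy X"
  proof (rule CauchyI)
    fix e :: real
    assume "e > 0"
    then obtain n where n: "4 / e\<^sup>2 < Suc n"
      using reals_Archimedean2 by (metis less_Suc_eq of_nat_less_iff order_less_trans)
    have "norm (X i - X j) < e" if "i \<ge> n" "j \<ge> n" for i j
    proof -
      have "(norm (X i - X j))\<^sup>2 < 4 / Suc n"
        by (rule close[OF that])
      also have "\<dots> < e\<^sup>2"
        using n \<open>e > 0\<close> by (simp add: field_simps)
      finally show ?thesis
        using \<open>e > 0\<close> power_less_imp_less_base by fastforce
    qed
    then show "\<exists>M. \<forall>m\<ge>M. \<forall>n\<ge>M. norm (X m - X n) < e"
      by blast
  qed
  then obtain k where k: "X \<longlonglongrightarrow> k"
    using Cauchy_convergent_iff convergent_def by blast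
  have "(\<lambda>n. J (X n)) \<longlonglongrightarrow> J k"
    unfolding J_def by (intro tendsto_intros \<phi>.tendsto k)
  moreover have "(\<lambda>n. m + 1 / Suc n) \<longlonglongrightarrow> m + 0"
    by (intro tendsto_intros LIMSEQ_Suc lim_1_over_n)
  ultimately have "J k \<le> m + 0"
    by (rule LIMSEQ_le) (use X less_imp_le in blast)
  then have Jk: "J k \<le> J x" for x
    using mJ[of x] by simp
  have Re_eq: "Re (\<phi> x) = Re (cinner x k)" for x
  proof -
    define d where "d = Re (cinner x k) - Re (\<phi> x)"
    have quad: "0 \<le> 2 * t * d + t\<^sup>2 * (norm x)\<^sup>2" for t
      using Jk[of "k + t *\<^sub>R x"] Re_cinner_commute[of k x]
      unfolding J_def norm_add_sq d_def
      by (simp add: \<phi>.add \<phi>.scaleR cinner_scaleR_right power_mult_distrib algebra_simps)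
    \<comment> \<open>The best \<open>t\<close> would be \<open>- d / |x|^2\<close>; adding 1 to the
      denominator covers \<open>x = 0\<close> and still makes the quadratic negative unless
      \<open>d = 0\<close>.\<close>
    define s where "s = 1 + (norm x)\<^sup>2"
    have s: "s > 0" "(norm x)\<^sup>2 = s - 1"
      by (simp_all add: s_def add_pos_nonneg)
    have "0 \<le> 2 * (- d / s) * d + (- d / s)\<^sup>2 * (norm x)\<^sup>2"
      by (rule quad)
    also have "\<dots> = - (d\<^sup>2 * (s + 1)) / s\<^sup>2"
      unfolding s(2) using s(1) by (simp add: field_simps power2_eq_square)
    finally have "d\<^sup>2 * (s + 1) \<le> 0"
      using s(1) by (simp add: divide_le_0_iff)
    then have "d = 0"
      using s(1) by (simp add: mult_le_0_iff)
    then show ?thesis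
      by (simp add: d_def)
  qed
  have "\<phi> x = cinner x k" for x
  proof (rule complex_eqI)
    show "Im (\<phi> x) = Im (cinner x k)"
      using Re_eq[of "\<i> *\<^sub>C x"] by (simp add: sc cinner_scaleC_left)
  qed (rule Re_eq)
  then show ?thesis
    by blast
qed

section \<open>Adjoints\<close>

text \<open>Riesz representation gives \<open>S y\<close> for each \<open>y\<close>, and
  \<open>|S u|^2 = Re <T (S u), u>\<close> bounds \<open>S\<close> by \<open>norm T\<close>. As
  vectors are determined by their inner products, \<open>S\<close> is the unique operator described
  by \<open>adj\<close>.\<close>

lemma adj_cinner:
  fixes T :: "'a::complex_hilbert \<Rightarrow>\<^sub>L 'a"
  assumes T: "complex_linear T"
  shows "cinner (T x) y = cinner x (adj T y)"
proof -
  have "\<exists>k. \<forall>x. cinner (T x) y = cinner x k" for y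
  proof (rule Riesz_representation)
    show "bounded_linear (\<lambda>x. cinner (T x) y)"
      by (intro bounded_linear_compose[OF cinner.bounded_linear_left] blinfun.bounded_linear_right)
    show "cinner (T (c *\<^sub>C x)) y = c * cinner (T x) y" for c x
      using T by (simp add: complex_linear_def cinner_scaleC_left)
  qed
  then obtain S where S: "\<And>x y. cinner (T x) y = cinner x (S y)"
    by metis
  have bl: "bounded_linear S"
  proof (rule bounded_linear_intro[where K = "norm T"])
    show "S (u + v) = S u + S v" for u v
      by (rule cinner_ext) (simp add: cinner.add_right flip: S)
    show "S (r *\<^sub>R u) = r *\<^sub>R S u" for r u
      by (rule cinner_ext) (simp add: cinner.scaleR_right flip: S)
    show "norm (S u) \<le> norm u * norm T" for u
    proof (cases "S u = 0")
      case False
      have "(norm (S u))\<^sup>2 = Re (cinner (T (S u)) u)"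
        by (simp add: S)
      also have "\<dots> \<le> norm (T (S u)) * norm u"
        using abs_Re_cinner_le[of "T (S u)" u] by linarith
      also have "\<dots> \<le> (norm T * norm (S u)) * norm u"
        by (intro mult_right_mono norm_blinfun norm_ge_zero)
      finally show ?thesis
        using False by (simp add: power2_eq_square mult.commute mult.left_commute)
    qed simp
  qed
  have "adj T = Blinfun S"
    unfolding adj_def
  proof (rule the_equality)
    show "\<forall>x y. cinner (T x) y = cinner x (Blinfun S y)"
      by (simp add: bounded_linear_Blinfun_apply[OF bl] S)
    fix S' :: "'a \<Rightarrow>\<^sub>L 'a"
    assume "\<forall>x y. cinner (T x) y = cinner x (S' y)"
    then have "S' y = S y" for y
      using S by (metis cinner_ext)
    then show "S' = Blinfun S"
      by (intro blinfun_eqI) (simp add: bounded_linear_Blinfun_apply[OF bl])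
  qed
  then show ?thesis
    by (simp add: S bounded_linear_Blinfun_apply[OF bl])
qed

lemma cinner_adj:
  assumes "complex_linear T"
  shows "cinner (adj T x) y = cinner x (T y)"
  using adj_cinner[OF assms, of y x] by (metis cinner_commute)

lemma complex_linear_adj:
  assumes "complex_linear T"
  shows "complex_linear (adj T)"
proof -
  have "adj T (c *\<^sub>C x) = c *\<^sub>C adj T x" for c x
    by (rule cinner_ext) (simp add: cinner_scaleC_right flip: adj_cinner[OF assms])
  then show ?thesis
    by (simp add: complex_linear_def)
qed

lemma adj_adj:
  assumes "complex_linear T"
  shows "adj (adj T) = T"
proof (rule blinfun_eqI, rule cinner_ext)
  show "cinner x (adj (adj T) y) = cinner x (T y)" for x y
    by (rule trans[OF adj_cinner[OF complex_linear_adj[OF assms], symmetric] cinner_adj[OF assms]])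
qed

section \<open>Invertibility and the spectrum\<close>

text \<open>Stated for plain functions, so that it applies directly to expressions such as
  \<open>T x - z x\<close> and to polynomials in \<open>T\<close> without packaging them as bounded
  operators.\<close>

definition cinvertible :: "('a::complex_hilbert \<Rightarrow> 'a) \<Rightarrow> bool"
  where "cinvertible F \<longleftrightarrow>
    (\<exists>S. complex_linear S \<and> (\<forall>x. blinfun_apply S (F x) = x) \<and> (\<forall>x. F (blinfun_apply S x) = x))"

lemma in_spectrum_iff: "z \<in> spectrum T \<longleftrightarrow> \<not> cinvertible (\<lambda>x. T x - z *\<^sub>C x)"
  by (simp add: spectrum_def cinvertible_def)

lemma cinvertible_compose:
  assumes "cinvertible F" "cinvertible G"
  shows "cinvertible (\<lambda>x. F (G x))"
proof -
  obtain S R where SR: "complex_linear S" "\<And>x. blinfun_apply S (F x) = x" "\<And>x. F (blinfun_apply S x) = x"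
    "complex_linear R" "\<And>x. blinfun_apply R (G x) = x" "\<And>x. G (blinfun_apply R x) = x"
    using assms unfolding cinvertible_def by metis
  have "complex_linear (R o\<^sub>L S)"
    using SR(1,4) by (simp add: complex_linear_def)
  then show ?thesis
    unfolding cinvertible_def by (intro exI[of _ "R o\<^sub>L S"]) (simp add: SR)
qed

lemma cinvertible_scaleC:
  assumes "c \<noteq> 0"
  shows "cinvertible ((*\<^sub>C) c :: 'a::complex_hilbert \<Rightarrow> 'a)"
  unfolding cinvertible_def
proof (intro exI conjI allI)
  let ?S = "Blinfun (\<lambda>x :: 'a. inverse c *\<^sub>C x)"
  have S: "?S x = inverse c *\<^sub>C x" for x
    by (rule bounded_linear_Blinfun_apply[OF bounded_linear_scaleC, THEN fun_cong])
  show "complex_linear ?S"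
    by (simp add: complex_linear_def S scaleC_scaleC mult.commute)
  show "?S (c *\<^sub>C x) = x" "c *\<^sub>C ?S x = x" for x
    using assms by (simp_all add: S scaleC_scaleC)
qed

lemma cinvertible_scaleC_cancel:
  fixes F :: "'a::complex_hilbert \<Rightarrow> 'a"
  assumes "cinvertible (\<lambda>x. c *\<^sub>C F x)" "c \<noteq> 0"
  shows "cinvertible F"
proof -
  have "cinvertible ((*\<^sub>C) (inverse c) :: 'a \<Rightarrow> 'a)"
    by (rule cinvertible_scaleC) (use assms(2) in simp)
  from cinvertible_compose[OF this assms(1)] show ?thesis
    using assms(2) by (simp add: scaleC_scaleC)
qed

text \<open>The solution of \<open>F x = y\<close> is the fixed point of the contraction
  \<open>x \<mapsto> x - \<epsilon> (F x - y)\<close> with \<open>\<epsilon> = s / K\<^sup>2\<close>.\<close>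

lemma Lax_Milgram:
  fixes F :: "'a::complex_hilbert \<Rightarrow> 'a"
  assumes bl: "bounded_linear F" and sc: "\<And>c x. F (c *\<^sub>C x) = c *\<^sub>C F x"
    and s: "s > 0" and coercive: "\<And>x. s * (norm x)\<^sup>2 \<le> Re (cinner (F x) x)"
  shows "cinvertible F"
proof -
  interpret F: bounded_linear F
    by (rule bl)
  obtain K0 where K0: "K0 > 0" "\<And>x. norm (F x) \<le> norm x * K0"
    using F.pos_bounded by blast
  \<comment> \<open>Adding \<open>s\<close> to the bound forces \<open>s < K\<close>, which keeps
    \<open>1 - s^2 / K^2\<close> strictly between 0 and 1.\<close>
  define K where "K = K0 + s"
  have K: "K > 0" "s < K" "norm (F x) \<le> K * norm x" for x
  proof -
    have "norm x * K0 \<le> norm x * K"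
      using s by (intro mult_left_mono) (simp_all add: K_def)
    with K0(2)[of x] show "norm (F x) \<le> K * norm x"
      by (simp add: mult.commute)
  qed (use K0(1) s in \<open>simp_all add: K_def\<close>)
  define \<epsilon> where "\<epsilon> = s / K\<^sup>2"
  \<comment> \<open>The contraction factor: its square is
    \<open>1 - 2 \<epsilon> s + \<epsilon>^2 K^2\<close>, where coercivity gives the middle term and
    boundedness the last.\<close>
  define c where "c = sqrt (1 - s\<^sup>2 / K\<^sup>2)"
  have frac: "0 < s\<^sup>2 / K\<^sup>2" "s\<^sup>2 / K\<^sup>2 < 1"
    using s K(1,2) by (simp_all add: power_strict_mono)
  have c: "0 \<le> c" "c < 1" "c\<^sup>2 = 1 - s\<^sup>2 / K\<^sup>2"
    using frac by (simp_all add: c_def)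
  have \<epsilon>: "\<epsilon> > 0"
    using s K(1) by (simp add: \<epsilon>_def)
  have contr: "norm (d - \<epsilon> *\<^sub>R F d) \<le> c * norm d" for d
  proof -
    have "(norm (d - \<epsilon> *\<^sub>R F d))\<^sup>2 = (norm d)\<^sup>2 - 2 * \<epsilon> * Re (cinner (F d) d) + \<epsilon>\<^sup>2 * (norm (F d))\<^sup>2"
      using Re_cinner_commute[of d "F d"]
      by (simp add: norm_diff_sq cinner.scaleR_right power_mult_distrib)
    also have "\<dots> \<le> (norm d)\<^sup>2 - 2 * \<epsilon> * (s * (norm d)\<^sup>2) + \<epsilon>\<^sup>2 * (K * norm d)\<^sup>2"
      using \<epsilon> by (intro add_mono diff_left_mono mult_left_mono coercive power_mono K(3)) auto
    also have "\<dots> = (c * norm d)\<^sup>2"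
    proof -
      have "\<epsilon> * s = s\<^sup>2 / K\<^sup>2" "\<epsilon>\<^sup>2 * K\<^sup>2 = s\<^sup>2 / K\<^sup>2"
        using K(1) by (simp_all add: \<epsilon>_def power2_eq_square)
      then show ?thesis
        unfolding power_mult_distrib c(3) by algebra
    qed
    finally show ?thesis
      by (rule power2_le_imp_le) (simp add: c(1))
  qed
  have ex1: "\<exists>!x. F x = y" for y
  proof -
    have "\<exists>!x. x - \<epsilon> *\<^sub>R (F x - y) = x"
    proof (rule banach_fix_type[OF c(1,2)], intro allI)
      fix x x'
      have "x - \<epsilon> *\<^sub>R (F x - y) - (x' - \<epsilon> *\<^sub>R (F x' - y)) = (x - x') - \<epsilon> *\<^sub>R F (x - x')"
        by (simp add: F.diff algebra_simps)
      then show "dist (x - \<epsilon> *\<^sub>R (F x - y)) (x' - \<epsilon> *\<^sub>R (F x' - y)) \<le> c * dist x x'"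
        unfolding dist_norm using contr[of "x - x'"] by (simp only:)
    qed
    then show ?thesis
      using \<epsilon> by simp
  qed
  define S where "S y = (THE x. F x = y)" for y
  have FS: "F (S y) = y" for y
    unfolding S_def by (rule theI'[OF ex1])
  have SF: "S (F x) = x" for x
    using ex1 FS by blast
  have blS: "bounded_linear S"
  proof (rule bounded_linear_intro[where K = "1 / s"])
    show "S (x + y) = S x + S y" for x y
      by (metis FS SF F.add)
    show "S (r *\<^sub>R x) = r *\<^sub>R S x" for r x
      by (metis FS SF F.scaleR)
    show "norm (S y) \<le> norm y * (1 / s)" for y
    proof (cases "S y = 0")
      case False
      have "s * (norm (S y))\<^sup>2 \<le> norm y * norm (S y)"
        using coercive[of "S y"] abs_Re_cinner_le[of y "S y"] by (simp add: FS)
      then show ?thesis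
        using False s by (simp add: power2_eq_square field_simps)
    qed (use s in simp)
  qed
  have "complex_linear (Blinfun S)"
    unfolding complex_linear_def bounded_linear_Blinfun_apply[OF blS] by (metis FS SF sc)
  then show ?thesis
    unfolding cinvertible_def
    by (intro exI[of _ "Blinfun S"]) (simp add: bounded_linear_Blinfun_apply[OF blS] FS SF)
qed

text \<open>Lax-Milgram applied to \<open>c (T - z)\<close>: the scalar \<open>c\<close> rotates the
  quadratic form of \<open>T - z\<close> until its real part is coercive, and can be cancelled
  afterwards.\<close>

lemma notin_spectrumI:
  assumes T: "complex_linear T" and c: "c \<noteq> 0" and s: "s > 0"
    and coercive: "\<And>x. s * (norm x)\<^sup>2 \<le> Re (c * (cinner (T x) x - z * cinner x x))"
  shows "z \<notin> spectrum T"
proof -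
  have "cinvertible (\<lambda>x. c *\<^sub>C (T x - z *\<^sub>C x))"
  proof (rule Lax_Milgram[OF _ _ s])
    show "bounded_linear (\<lambda>x. c *\<^sub>C (T x - z *\<^sub>C x))"
      by (intro bounded_linear_compose[OF bounded_linear_scaleC] bounded_linear_sub
          blinfun.bounded_linear_right bounded_linear_scaleC)
    show "c *\<^sub>C (T (d *\<^sub>C x) - z *\<^sub>C d *\<^sub>C x) = d *\<^sub>C c *\<^sub>C (T x - z *\<^sub>C x)" for d x
      using T by (simp add: complex_linear_def scaleC_diff_right scaleC_scaleC mult.commute mult.left_commute)
    show "s * (norm x)\<^sup>2 \<le> Re (cinner (c *\<^sub>C (T x - z *\<^sub>C x)) x)" for x
      using coercive[of x] by (simp add: cinner_scaleC_left cinner.diff_left)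
  qed
  then show ?thesis
    using c by (simp add: in_spectrum_iff cinvertible_scaleC_cancel)
qed

section \<open>Self-adjoint and positive operators and the location of their spectra\<close>

definition selfadjoint :: "('a::complex_hilbert \<Rightarrow>\<^sub>L 'a) \<Rightarrow> bool"
  where "selfadjoint T \<longleftrightarrow> (\<forall>x y. cinner (T x) y = cinner x (T y))"

definition positive_op :: "('a::complex_hilbert \<Rightarrow>\<^sub>L 'a) \<Rightarrow> bool"
  where "positive_op T \<longleftrightarrow> selfadjoint T \<and> (\<forall>x. 0 \<le> Re (cinner (T x) x))"

lemma selfadjointD: "selfadjoint T \<Longrightarrow> cinner (T x) y = cinner x (T y)"
  by (simp add: selfadjoint_def)

lemma selfadjoint_imp_complex_linear:
  assumes "selfadjoint T"
  shows "complex_linear T"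
proof -
  have "T (c *\<^sub>C x) = c *\<^sub>C T x" for c x
    by (rule cinner_ext) (simp add: cinner_scaleC_right flip: selfadjointD[OF assms])
  then show ?thesis
    by (simp add: complex_linear_def)
qed

lemma Im_cinner_selfadjoint:
  assumes "selfadjoint T"
  shows "Im (cinner (T x) x) = 0"
  using cinner_commute[of "T x" x] selfadjointD[OF assms, of x x] by (simp add: complex_eq_iff)

lemma spectrum_selfadjoint_real:
  assumes T: "selfadjoint T" and z: "z \<in> spectrum T"
  shows "z = complex_of_real (Re z)"
proof (rule ccontr)
  assume "z \<noteq> complex_of_real (Re z)"
  then have b: "Im z \<noteq> 0"
    by (simp add: complex_eq_iff)
  have "z \<notin> spectrum T"
  proof (rule notin_spectrumI)
    \<comment> \<open>As \<open><T x, x>\<close> is real, multiplying by \<open>i Im z\<close>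
      leaves exactly \<open>(Im z)^2 |x|^2\<close> in the real part.\<close>
    show "(Im z)\<^sup>2 * (norm x)\<^sup>2 \<le> Re (\<i> * Im z * (cinner (T x) x - z * cinner x x))" for x
      using Im_cinner_selfadjoint[OF T, of x] by (simp add: cinner_same power2_eq_square)
  qed (use b T in \<open>simp_all add: selfadjoint_imp_complex_linear\<close>)
  with z show False
    by simp
qed

lemma abs_Re_cinner_blinfun_le: "\<bar>Re (cinner (blinfun_apply T x) x)\<bar> \<le> norm T * (norm x)\<^sup>2"
proof -
  have "\<bar>Re (cinner (blinfun_apply T x) x)\<bar> \<le> norm (T x) * norm x"
    by (rule abs_Re_cinner_le)
  also have "\<dots> \<le> norm T * norm x * norm x"
    by (intro mult_right_mono norm_blinfun norm_ge_zero)
  finally show ?thesis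
    by (simp add: power2_eq_square mult.assoc)
qed

text \<open>For \<open>t < 0\<close> the operator \<open>T - t\<close> is coercive; for
  \<open>t > norm T\<close> the operator \<open>t - T\<close> is.\<close>

lemma spectrum_positive:
  assumes T: "positive_op T" and t: "complex_of_real t \<in> spectrum T"
  shows "t \<in> {0..norm T}"
proof -
  have T': "complex_linear T" and pos: "\<And>x. 0 \<le> Re (cinner (T x) x)"
    using T by (simp_all add: positive_op_def selfadjoint_imp_complex_linear)
  have "complex_of_real t \<notin> spectrum T" if "t < 0"
    using notin_spectrumI[OF T', of 1 "- t" "complex_of_real t"] pos that by (simp add: cinner_same)
  moreover have "complex_of_real t \<notin> spectrum T" if "t > norm T"
  proof (rule notin_spectrumI[OF T'])
    show "(t - norm T) * (norm x)\<^sup>2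
        \<le> Re (- 1 * (cinner (T x) x - complex_of_real t * cinner x x))" for x
      using abs_Re_cinner_blinfun_le[of T x] by (simp add: cinner_same left_diff_distrib)
  qed (use that in simp_all)
  ultimately show ?thesis
    using t by force
qed

text \<open>If neither \<open>norm S\<close> nor its negative were a spectral value,
  \<open>S^2 - (norm S)^2\<close> would have a bounded inverse. The resulting lower bound pushes
  \<open>|S x|\<close> below \<open>norm S * |x|\<close> by a uniform factor, a contradiction. The
  zero space is excluded because every spectrum there is empty.\<close>

lemma norm_in_spectrum:
  fixes S :: "'a::complex_hilbert \<Rightarrow>\<^sub>L 'a"
  assumes S: "selfadjoint S" and ne: "\<exists>x :: 'a. x \<noteq> 0"
  shows "\<exists>t. \<bar>t\<bar> = norm S \<and> complex_of_real t \<in> spectrum S"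
proof (rule ccontr)
  assume "\<not> ?thesis"
  then have "complex_of_real (norm S) \<notin> spectrum S" "complex_of_real (- norm S) \<notin> spectrum S"
    by (auto simp del: of_real_minus)
  then have "cinvertible (\<lambda>x. S x - complex_of_real (norm S) *\<^sub>C x)"
    "cinvertible (\<lambda>x. S x - complex_of_real (- norm S) *\<^sub>C x)"
    by (simp_all only: in_spectrum_iff not_not)
  then have "cinvertible (\<lambda>x. S (S x - complex_of_real (- norm S) *\<^sub>C x)
      - complex_of_real (norm S) *\<^sub>C (S x - complex_of_real (- norm S) *\<^sub>C x))"
    by (rule cinvertible_compose)
  then obtain V where V0: "\<And>x. blinfun_apply V (S (S x - complex_of_real (- norm S) *\<^sub>C x)
      - complex_of_real (norm S) *\<^sub>C (S x - complex_of_real (- norm S) *\<^sub>C x)) = x"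
    unfolding cinvertible_def by blast
  have V: "V (S (S x) - (norm S)\<^sup>2 *\<^sub>R x) = x" for x
  proof -
    have "S (S x - complex_of_real (- norm S) *\<^sub>C x)
        - complex_of_real (norm S) *\<^sub>C (S x - complex_of_real (- norm S) *\<^sub>C x)
        = S (S x) - (norm S)\<^sup>2 *\<^sub>R x"
      unfolding scaleC_of_real
      by (simp add: blinfun.add_right blinfun.scaleR_right scaleR_add_right power2_eq_square)
    then show ?thesis
      using V0[of x] by simp
  qed
  define s where "s = norm S"
  define C where "C = norm V"
  obtain x0 :: 'a where "x0 \<noteq> 0"
    using ne by blast
  then have "V \<noteq> 0" "S \<noteq> 0"
    using V[of x0] by auto
  then have C: "C > 0" and s: "s > 0"
    by (simp_all add: C_def s_def)
  \<comment> \<open>The gap in \<open>|S x|^2 <= (s^2 - r) |x|^2\<close>, obtained by dividing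
    \<open>|x|^2 <= C^2 s^2 (s^2 |x|^2 - |S x|^2)\<close> by \<open>C^2 s^2\<close>.\<close>
  define r where "r = 1 / (C\<^sup>2 * s\<^sup>2)"
  have r: "r > 0"
    using C s by (simp add: r_def)
  have bound: "(norm (S x))\<^sup>2 \<le> (s\<^sup>2 - r) * (norm x)\<^sup>2" for x
  proof -
    have "norm x \<le> C * norm (S (S x) - s\<^sup>2 *\<^sub>R x)"
      using norm_blinfun[of V "S (S x) - s\<^sup>2 *\<^sub>R x"] V[of x] by (simp add: C_def s_def)
    then have "(norm x)\<^sup>2 \<le> C\<^sup>2 * (norm (S (S x) - s\<^sup>2 *\<^sub>R x))\<^sup>2"
      by (metis power_mono norm_ge_zero power_mult_distrib)
    \<comment> \<open>Self-adjointness turns the mixed term \<open><S (S x), x>\<close> into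
      \<open>|S x|^2\<close>.\<close>
    also have "(norm (S (S x) - s\<^sup>2 *\<^sub>R x))\<^sup>2 = (norm (S (S x)))\<^sup>2 - 2 * s\<^sup>2 * (norm (S x))\<^sup>2 + (s\<^sup>2 * norm x)\<^sup>2"
      by (simp add: norm_diff_sq cinner.scaleR_right selfadjointD[OF S, of "S x" x] power_mult_distrib)
    also have "\<dots> \<le> (s * norm (S x))\<^sup>2 - 2 * s\<^sup>2 * (norm (S x))\<^sup>2 + (s\<^sup>2 * norm x)\<^sup>2"
      using norm_blinfun[of S "S x"] by (intro add_right_mono diff_right_mono power_mono) (simp_all add: s_def)
    also have "\<dots> = s\<^sup>2 * (s\<^sup>2 * (norm x)\<^sup>2 - (norm (S x))\<^sup>2)"
      by (simp add: power_mult_distrib algebra_simps power2_eq_square)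
    finally have "(norm x)\<^sup>2 \<le> C\<^sup>2 * (s\<^sup>2 * (s\<^sup>2 * (norm x)\<^sup>2 - (norm (S x))\<^sup>2))"
      using C by simp
    then have "r * (norm x)\<^sup>2 \<le> s\<^sup>2 * (norm x)\<^sup>2 - (norm (S x))\<^sup>2"
      using C s by (simp add: r_def divide_le_eq mult_ac)
    then show ?thesis
      by (simp add: algebra_simps)
  qed
  have nn: "0 \<le> s\<^sup>2 - r"
    using bound[of x0] \<open>x0 \<noteq> 0\<close> by (metis zero_le_power2 order_trans zero_le_mult_iff norm_eq_zero not_le
        mult_less_0_iff zero_less_power2)
  have "norm (S x) \<le> sqrt (s\<^sup>2 - r) * norm x" for x
    using real_sqrt_le_mono[OF bound[of x]] by (simp add: real_sqrt_mult)
  then have "norm S \<le> sqrt (s\<^sup>2 - r)"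
    using nn by (intro norm_blinfun_bound) simp_all
  then have "s\<^sup>2 \<le> s\<^sup>2 - r"
    using nn s by (metis s_def real_sqrt_pow2 power_mono less_imp_le)
  with r show False
    by simp
qed

section \<open>Polynomials of an operator\<close>

lemma power_blinfun_apply:
  fixes T :: "'a::real_normed_vector \<Rightarrow>\<^sub>L 'a"
  shows "blinfun_apply ((((o\<^sub>L) T) ^^ i) id_blinfun) x = (blinfun_apply T ^^ i) x"
  by (induction i) simp_all

text \<open>Padding with zero coefficients lets the recursion for \<open>pCons\<close> be read off
  without knowing the exact degree.\<close>

lemma op_poly_apply:
  assumes "degree p \<le> n"
  shows "op_poly p T x = (\<Sum>i\<le>n. coeff p i *\<^sub>R (blinfun_apply T ^^ i) x)"
proof -
  have "op_poly p T x = (\<Sum>i\<le>degree p. coeff p i *\<^sub>R (blinfun_apply T ^^ i) x)"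
    by (simp add: op_poly_def blinfun.sum_left blinfun.scaleR_left power_blinfun_apply)
  also have "\<dots> = (\<Sum>i\<le>n. coeff p i *\<^sub>R (blinfun_apply T ^^ i) x)"
    using assms by (intro sum.mono_neutral_left) (auto simp: coeff_eq_0)
  finally show ?thesis .
qed

lemma op_poly_0 [simp]: "op_poly 0 T x = 0"
  by (simp add: op_poly_def)

lemma op_poly_pCons: "op_poly (pCons a p) T x = a *\<^sub>R x + T (op_poly p T x)"
  unfolding op_poly_apply[OF degree_pCons_le, of a p] op_poly_apply[OF order_refl, of p]
    sum.atMost_Suc_shift
  by (simp add: blinfun.sum_right blinfun.scaleR_right)

lemma op_poly_const: "op_poly [:a:] T x = a *\<^sub>R x"
  by (simp add: op_poly_pCons)

lemma op_poly_add: "op_poly (p + q) T x = op_poly p T x + op_poly q T x"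
proof (induction p arbitrary: q)
  case (pCons a p)
  then show ?case
    by (cases q) (simp add: op_poly_pCons scaleR_add_left blinfun.add_right)
qed simp

lemma op_poly_smult: "op_poly (smult c p) T x = c *\<^sub>R op_poly p T x"
  by (induction p) (simp_all add: op_poly_pCons scaleR_add_right blinfun.scaleR_right)

lemma op_poly_diff: "op_poly (p - q) T = op_poly p T - op_poly q T"
  by (rule blinfun_eqI)
    (use op_poly_add[of p "smult (-1) q" T] op_poly_smult[of "-1" q T] in \<open>simp add: blinfun.diff_left\<close>)

lemma op_poly_mult: "op_poly (p * q) T x = op_poly p T (op_poly q T x)"
  by (induction p) (simp_all add: op_poly_pCons op_poly_add op_poly_smult)

lemma op_poly_X: "op_poly [:0, 1:] T x = T x"
  by (simp add: op_poly_pCons)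

text \<open>The relation \<open>T B = C T\<close> passes to powers and linear combinations. It
  serves to move polynomials across \<open>T\<close>, first from \<open>adj T T\<close> to
  \<open>T adj T\<close>, later from \<open>|T|\<close> to \<open>|adj T|\<close>.\<close>

lemma op_poly_intertwine:
  assumes "\<And>x. blinfun_apply T (blinfun_apply B x) = blinfun_apply C (blinfun_apply T x)"
  shows "blinfun_apply T (op_poly p B x) = op_poly p C (T x)"
  by (induction p) (simp_all add: op_poly_pCons blinfun.add_right blinfun.scaleR_right assms)

lemma selfadjoint_op_poly:
  assumes "selfadjoint T"
  shows "selfadjoint (op_poly p T)"
proof -
  have comm: "op_poly p T (T x) = T (op_poly p T x)" for p x
    by (induction p) (simp_all add: op_poly_pCons blinfun.add_right blinfun.scaleR_right)
  have "cinner (op_poly p T x) y = cinner x (op_poly p T y)" for x y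
    by (induction p arbitrary: x y)
      (simp_all add: op_poly_pCons cinner.add_left cinner.add_right cinner.scaleR_left
        cinner.scaleR_right cinner.zero_left cinner.zero_right selfadjointD[OF assms] comm)
  then show ?thesis
    by (simp add: selfadjoint_def)
qed

text \<open>Complex polynomials are only needed to factor \<open>p - \<mu>\<close> into linear factors.\<close>

definition op_cpoly :: "complex poly \<Rightarrow> ('a::complex_hilbert \<Rightarrow> 'a) \<Rightarrow> 'a \<Rightarrow> 'a"
  where "op_cpoly p F x = (\<Sum>i\<le>degree p. coeff p i *\<^sub>C (F ^^ i) x)"

lemma op_cpoly_sum:
  assumes "degree p \<le> n"
  shows "op_cpoly p F x = (\<Sum>i\<le>n. coeff p i *\<^sub>C (F ^^ i) x)"
  unfolding op_cpoly_def using assms by (intro sum.mono_neutral_left) (auto simp: coeff_eq_0)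

lemma op_cpoly_0 [simp]: "op_cpoly 0 F x = 0"
  by (simp add: op_cpoly_def)

lemma op_cpoly_pCons:
  assumes "complex_linear T"
  shows "op_cpoly (pCons a p) T x = a *\<^sub>C x + T (op_cpoly p T x)"
  unfolding op_cpoly_sum[OF degree_pCons_le, of a p] op_cpoly_sum[OF order_refl, of p]
    sum.atMost_Suc_shift
  using assms by (simp add: blinfun.sum_right complex_linear_def)

lemma op_cpoly_add:
  assumes "complex_linear T"
  shows "op_cpoly (p + q) T x = op_cpoly p T x + op_cpoly q T x"
proof (induction p arbitrary: q)
  case (pCons a p)
  then show ?case
    by (cases q) (simp add: op_cpoly_pCons[OF assms] scaleC_add_left blinfun.add_right)
qed simp

lemma op_cpoly_smult:
  assumes T: "complex_linear T"
  shows "op_cpoly (smult c p) T x = c *\<^sub>C op_cpoly p T x"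
  using T by (induction p)
    (simp_all add: op_cpoly_pCons scaleC_add_right scaleC_scaleC complex_linear_def)

lemma op_cpoly_of_real:
  assumes T: "complex_linear T"
  shows "op_cpoly (map_poly complex_of_real p) T x = op_poly p T x"
  by (induction p) (simp_all add: map_poly_pCons op_cpoly_pCons[OF T] op_poly_pCons scaleC_of_real)

lemma poly_map_poly_of_real: "poly (map_poly complex_of_real p) (of_real t) = of_real (poly p t)"
  by (induction p) (simp_all add: map_poly_pCons)

text \<open>Splitting off a root \<open>z\<close> writes \<open>p(T)\<close> as
  \<open>(T - z) q(T)\<close>, a composition of invertible maps by induction. A polynomial without
  roots is a nonzero constant by the fundamental theorem of algebra.\<close>

lemma cinvertible_op_cpoly:
  assumes T: "complex_linear T"
  shows "p \<noteq> 0 \<Longrightarrow> (\<And>z. poly p z = 0 \<Longrightarrow> z \<notin> spectrum T) \<Longrightarrow> cinvertible (op_cpoly p T)"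
proof (induction "degree p" arbitrary: p rule: less_induct)
  case less
  show ?case
  proof (cases "\<exists>z. poly p z = 0")
    case True
    then obtain z where z: "poly p z = 0"
      by blast
    then obtain q where q: "p = [:- z, 1:] * q"
      by (auto simp: poly_eq_0_iff_dvd elim: dvdE)
    with less.prems(1) have q0: "q \<noteq> 0"
      by auto
    then have deg: "degree q < degree p"
      unfolding q by (subst degree_mult_eq) auto
    have "cinvertible (op_cpoly q T)"
      by (rule less.hyps[OF deg q0]) (use less.prems(2) in \<open>auto simp: q\<close>)
    moreover have "cinvertible (\<lambda>x. T x - z *\<^sub>C x)"
      using less.prems(2)[OF z] by (simp add: in_spectrum_iff)
    moreover have "op_cpoly p T = (\<lambda>x. T (op_cpoly q T x) - z *\<^sub>C op_cpoly q T x)"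
    proof
      fix x
      have "p = smult (- z) q + pCons 0 q"
        by (simp add: q)
      then show "op_cpoly p T x = T (op_cpoly q T x) - z *\<^sub>C op_cpoly q T x"
        by (simp only: op_cpoly_add[OF T] op_cpoly_smult[OF T] op_cpoly_pCons[OF T] scaleC_minus_left
            scaleC_zero_left) simp
    qed
    ultimately show ?thesis
      using cinvertible_compose[of "\<lambda>x. T x - z *\<^sub>C x"] by simp
  next
    case False
    then obtain a where a: "a \<noteq> 0" "p = [:a:]"
      using fundamental_theorem_of_algebra_alt[of p] by auto
    have "op_cpoly p T = (*\<^sub>C) a"
      by (simp add: a fun_eq_iff op_cpoly_pCons[OF T])
    then show ?thesis
      using cinvertible_scaleC[OF a(1)] by simp
  qed
qed

text \<open>The spectral mapping theorem: \<open>\<plusminus>\<parallel>p(T)\<parallel>\<close> is a spectral value \<open>\<mu>\<close> of \<open>p(T)\<close>, so one of the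
  linear factors \<open>T - r\<close> of \<open>p(T) - \<mu>\<close> is not invertible.\<close>

lemma norm_op_poly_le:
  fixes T :: "'a::complex_hilbert \<Rightarrow>\<^sub>L 'a"
  assumes T: "selfadjoint T" and M: "0 \<le> M"
    and le: "\<And>t. complex_of_real t \<in> spectrum T \<Longrightarrow> \<bar>poly p t\<bar> \<le> M"
  shows "norm (op_poly p T) \<le> M"
proof (cases "\<exists>x :: 'a. x \<noteq> 0")
  case True
  note lin = selfadjoint_imp_complex_linear[OF T]
  obtain \<mu> where \<mu>: "\<bar>\<mu>\<bar> = norm (op_poly p T)" "complex_of_real \<mu> \<in> spectrum (op_poly p T)"
    using norm_in_spectrum[OF selfadjoint_op_poly[OF T] True] by blast
  define q where "q = p - [:\<mu>:]"
  have "op_cpoly (map_poly complex_of_real q) T = (\<lambda>x. op_poly p T x - complex_of_real \<mu> *\<^sub>C x)"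
    by (simp add: fun_eq_iff op_cpoly_of_real[OF lin] q_def op_poly_diff blinfun.diff_left
        op_poly_const scaleC_of_real)
  then have ninv: "\<not> cinvertible (op_cpoly (map_poly complex_of_real q) T)"
    using \<mu>(2) by (simp add: in_spectrum_iff)
  obtain t where t: "complex_of_real t \<in> spectrum T" "poly q t = 0"
  proof (cases "q = 0")
    case q0: True
    \<comment> \<open>Here \<open>p\<close> is the constant \<open>\<mu>\<close> and has no linear
      factor to offer; any spectral value of \<open>T\<close> serves, and one exists because the
      space is nonzero.\<close>
    obtain t where "complex_of_real t \<in> spectrum T"
      using norm_in_spectrum[OF T True] by blast
    with q0 that show ?thesis
      by simp
  next
    case False
    then have "map_poly complex_of_real q \<noteq> 0"
      by (simp add: map_poly_eq_0_iff)
    then obtain z where z: "poly (map_poly complex_of_real q) z = 0" "z \<in> spectrum T"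
      using cinvertible_op_cpoly[OF lin] ninv by blast
    then have "z = complex_of_real (Re z)"
      using spectrum_selfadjoint_real[OF T] by blast
    with z that[of "Re z"] show ?thesis
      using poly_map_poly_of_real[of q "Re z"] by (metis of_real_eq_0_iff)
  qed
  then have "poly p t = \<mu>"
    by (simp add: q_def)
  with le[OF t(1)] \<mu>(1) show ?thesis
    by simp
next
  case False
  then have "op_poly p T = 0"
    by (intro blinfun_eqI) metis
  with M show ?thesis
    by simp
qed

text \<open>Apply the norm bound to \<open>p - K/2\<close>, which lies between \<open>-K/2\<close> and \<open>K/2\<close> on the spectrum.\<close>

lemma op_poly_nonneg:
  assumes T: "selfadjoint T" and bd: "\<And>t. complex_of_real t \<in> spectrum T \<Longrightarrow> 0 \<le> poly p t"
    "\<And>t. complex_of_real t \<in> spectrum T \<Longrightarrow> poly p t \<le> K"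
    and K: "0 \<le> K"
  shows "0 \<le> Re (cinner (op_poly p T x) x)"
proof -
  define S where "S = op_poly (p - [:K/2:]) T"
  have "norm S \<le> K/2"
    unfolding S_def
  proof (rule norm_op_poly_le[OF T])
    show "\<bar>poly (p - [:K/2:]) t\<bar> \<le> K/2" if "complex_of_real t \<in> spectrum T" for t
      using bd[OF that] unfolding poly_diff by (simp only: poly_const_conv poly_pCons poly_0)
  qed (use K in simp)
  then have "norm S * (norm x)\<^sup>2 \<le> K/2 * (norm x)\<^sup>2"
    by (intro mult_right_mono) auto
  then have "\<bar>Re (cinner (S x) x)\<bar> \<le> K/2 * (norm x)\<^sup>2"
    using abs_Re_cinner_blinfun_le[of S x] by linarith
  moreover have "op_poly p T x = S x + (K/2) *\<^sub>R x"
    by (simp add: S_def op_poly_diff blinfun.diff_left op_poly_const)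
  ultimately show ?thesis
    by (simp add: cinner.add_left cinner.scaleR_left)
qed

section \<open>The continuous functional calculus\<close>

text \<open>By the spectral norm bound, polynomials uniformly close on the spectrum give operators
  close in norm, so all approximating sequences share one limit. The sequence \<open>q\<close>
  guarantees that there is such a sequence; otherwise every operator would satisfy the description
  in \<open>cfc\<close>.\<close>

lemma cfc_limit:
  fixes T :: "'a::complex_hilbert \<Rightarrow>\<^sub>L 'a"
  assumes T: "selfadjoint T"
    and q: "uniform_limit {t. complex_of_real t \<in> spectrum T} (\<lambda>m. poly (q m)) f sequentially"
    and p: "uniform_limit {t. complex_of_real t \<in> spectrum T} (\<lambda>m. poly (p m)) f sequentially"
  shows "(\<lambda>m. op_poly (p m) T) \<longlonglongrightarrow> cfc f T"
proof -
  define K where "K = {t. complex_of_real t \<in> spectrum T}"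
  have close: "norm (op_poly r T - op_poly s T) \<le> e"
    if "\<And>t. t \<in> K \<Longrightarrow> \<bar>poly r t - f t\<bar> < e/2" "\<And>t. t \<in> K \<Longrightarrow> \<bar>poly s t - f t\<bar> < e/2" "e > 0"
    for r s :: "real poly" and e
  proof -
    have "norm (op_poly (r - s) T) \<le> e"
    proof (rule norm_op_poly_le[OF T])
      fix t
      assume "complex_of_real t \<in> spectrum T"
      then have "t \<in> K"
        by (simp add: K_def)
      from that(1,2)[OF this] show "\<bar>poly (r - s) t\<bar> \<le> e"
        unfolding poly_diff by linarith
    qed (use that in simp)
    then show ?thesis
      by (simp add: op_poly_diff)
  qed
  have ev: "\<exists>N. \<forall>m\<ge>N. \<forall>t\<in>K. \<bar>poly (r m) t - f t\<bar> < e"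
    if "uniform_limit K (\<lambda>m. poly (r m)) f sequentially" "e > 0" for r e
    using uniform_limitD[OF that] by (simp add: eventually_sequentially dist_real_def)
  have "Cauchy (\<lambda>m. op_poly (q m) T)"
  proof (rule CauchyI)
    fix e :: real
    assume "e > 0"
    \<comment> \<open>\<open>close\<close> loses one factor 2 and yields only a weak inequality; the
      second halving makes the final bound strict.\<close>
    then obtain N where N: "\<And>m t. m \<ge> N \<Longrightarrow> t \<in> K \<Longrightarrow> \<bar>poly (q m) t - f t\<bar> < e/2/2"
      using ev[OF q[folded K_def], of "e/2/2"] by auto
    have "norm (op_poly (q m) T - op_poly (q n) T) < e" if "m \<ge> N" "n \<ge> N" for m n
      using close[of "q m" "e/2" "q n"] N that \<open>e > 0\<close> by force
    then show "\<exists>M. \<forall>m\<ge>M. \<forall>n\<ge>M. norm (op_poly (q m) T - op_poly (q n) T) < e"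
      by blast
  qed
  then obtain S where S: "(\<lambda>m. op_poly (q m) T) \<longlonglongrightarrow> S"
    using Cauchy_convergent_iff convergent_def by blast
  have lim: "(\<lambda>m. op_poly (r m) T) \<longlonglongrightarrow> S" if r: "uniform_limit K (\<lambda>m. poly (r m)) f sequentially" for r
  proof -
    have "(\<lambda>m. op_poly (r m) T - op_poly (q m) T) \<longlonglongrightarrow> 0"
    proof (rule LIMSEQ_I)
      fix e :: real
      assume "e > 0"
      then obtain N1 N2 where "\<forall>m\<ge>N1. \<forall>t\<in>K. \<bar>poly (q m) t - f t\<bar> < e/2/2"
        "\<forall>m\<ge>N2. \<forall>t\<in>K. \<bar>poly (r m) t - f t\<bar> < e/2/2"
        using ev[OF q[folded K_def], of "e/2/2"] ev[OF r, of "e/2/2"]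
        by (meson half_gt_zero)
      then have "norm (op_poly (r m) T - op_poly (q m) T) < e" if "m \<ge> max N1 N2" for m
        using close[of "r m" "e/2" "q m"] that \<open>e > 0\<close> by force
      then show "\<exists>N. \<forall>m\<ge>N. norm (op_poly (r m) T - op_poly (q m) T - 0) < e"
        by (intro exI[of _ "max N1 N2"]) simp
    qed
    from tendsto_add[OF this S] show ?thesis
      by simp
  qed
  have "cfc f T = S"
    unfolding cfc_def K_def[symmetric]
  proof (rule the_equality)
    show "\<forall>p. uniform_limit K (\<lambda>m. poly (p m)) f sequentially \<longrightarrow> (\<lambda>m. op_poly (p m) T) \<longlonglongrightarrow> S"
      using lim by blast
    show "S' = S"
      if "\<forall>p. uniform_limit K (\<lambda>m. poly (p m)) f sequentially \<longrightarrow> (\<lambda>m. op_poly (p m) T) \<longlonglongrightarrow> S'" for S'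
      using that q S LIMSEQ_unique unfolding K_def by blast
  qed
  then show ?thesis
    using lim p by (simp add: K_def)
qed

section \<open>Uniform polynomial approximation and its consequences for positive operators\<close>

lemma Weierstrass_poly_approx:
  fixes f :: "real \<Rightarrow> real"
  assumes "compact S" "continuous_on S f" "e > 0"
  shows "\<exists>p. \<forall>t\<in>S. \<bar>poly p t - f t\<bar> < e"
proof -
  obtain g where g: "real_polynomial_function g" "\<And>x. x \<in> S \<Longrightarrow> \<bar>f x - g x\<bar> < e"
    using Stone_Weierstrass_real_polynomial_function[OF assms] by blast
  then obtain a n where "g = (\<lambda>x. \<Sum>i\<le>n. a i * x ^ i)"
    by (auto simp: real_polynomial_function_iff_sum)
  then have "poly (\<Sum>i\<le>n. monom (a i) i) t = g t" for t
    by (simp add: poly_sum poly_monom)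
  with g(2) show ?thesis
    by (intro exI[of _ "\<Sum>i\<le>n. monom (a i) i"]) (simp add: abs_minus_commute)
qed

lemma Weierstrass_poly_limit:
  fixes f :: "real \<Rightarrow> real"
  assumes "compact S" "continuous_on S f"
  shows "\<exists>p. uniform_limit S (\<lambda>m. poly (p m)) f sequentially"
proof -
  have "\<exists>p. \<forall>t\<in>S. \<bar>poly p t - f t\<bar> < 1 / Suc m" for m
    by (rule Weierstrass_poly_approx[OF assms]) simp
  then obtain p where p: "\<And>m t. t \<in> S \<Longrightarrow> \<bar>poly (p m) t - f t\<bar> < 1 / Suc m"
    by metis
  have "uniform_limit S (\<lambda>m. poly (p m)) f sequentially"
  proof (rule uniform_limitI)
    fix e :: real
    assume "e > 0"
    then have "\<forall>\<^sub>F m in sequentially. 1 / Suc m < e"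
      using LIMSEQ_Suc[OF lim_1_over_n[where 'a = real]] by (simp add: order_tendsto_iff)
    then show "\<forall>\<^sub>F m in sequentially. \<forall>t\<in>S. dist (poly (p m) t) (f t) < e"
      by eventually_elim (use p less_trans in \<open>fastforce simp only: dist_real_def\<close>)
  qed
  then show ?thesis
    by blast
qed

text \<open>The interval \<open>{0..R}\<close> contains the spectrum. Leaving \<open>R\<close> free
  lets one sequence of polynomials serve two operators of different norms.\<close>

lemma cfc_limit_positive:
  assumes T: "positive_op T" and R: "norm T \<le> R"
    and p: "uniform_limit {0..R} (\<lambda>m. poly (p m)) f sequentially"
  shows "(\<lambda>m. op_poly (p m) T) \<longlonglongrightarrow> cfc f T"
proof -
  have "{t. complex_of_real t \<in> spectrum T} \<subseteq> {0..R}"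
    using spectrum_positive[OF T] R by fastforce
  then show ?thesis
    using T p by (intro cfc_limit) (auto simp: positive_op_def intro: uniform_limit_on_subset)
qed

text \<open>With \<open>q m\<close> approximating \<open>f\<close> within \<open>\<delta>\<close>,
  the polynomial \<open>q m + \<eta> + \<delta> - p\<close> is nonnegative on the spectrum, hence so
  is its operator; let \<open>m\<close> tend to infinity and then \<open>\<delta>\<close> to 0. The
  slack \<open>\<eta>\<close> allows for polynomials that only approximate a function below
  \<open>f\<close>.\<close>

lemma op_poly_le_cfc:
  assumes T: "positive_op T" and f: "continuous_on {0..} f" and R: "norm T \<le> R"
    and le: "\<And>t. t \<in> {0..R} \<Longrightarrow> poly p t \<le> f t + \<eta>"
  shows "Re (cinner (op_poly p T x) x) \<le> Re (cinner (cfc f T x) x) + \<eta> * (norm x)\<^sup>2"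
proof -
  have "continuous_on {0..R} f"
    by (rule continuous_on_subset[OF f]) auto
  then obtain q where q: "uniform_limit {0..R} (\<lambda>m. poly (q m)) f sequentially"
    using Weierstrass_poly_limit[OF compact_Icc] by blast
  have sa: "selfadjoint T"
    using T by (simp add: positive_op_def)
  have step: "Re (cinner (op_poly p T x) x) \<le> Re (cinner (cfc f T x) x) + (\<eta> + \<delta>) * (norm x)\<^sup>2"
    if \<delta>: "\<delta> > 0" for \<delta>
  proof (rule tendsto_lowerbound)
    show "(\<lambda>m. Re (cinner (op_poly (q m) T x) x) + (\<eta> + \<delta>) * (norm x)\<^sup>2)
      \<longlonglongrightarrow> Re (cinner (cfc f T x) x) + (\<eta> + \<delta>) * (norm x)\<^sup>2"
      by (intro tendsto_intros cinner.tendsto blinfun.tendsto cfc_limit_positive[OF T R q])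
    have "\<forall>\<^sub>F m in sequentially. \<forall>t\<in>{0..R}. dist (poly (q m) t) (f t) < \<delta>"
      by (rule uniform_limitD[OF q \<delta>])
    then show "\<forall>\<^sub>F m in sequentially. Re (cinner (op_poly p T x) x)
        \<le> Re (cinner (op_poly (q m) T x) x) + (\<eta> + \<delta>) * (norm x)\<^sup>2"
    proof eventually_elim
      case (elim m)
      define s where "s = q m + [:\<eta> + \<delta>:] - p"
      have s0: "0 \<le> poly s t" if "t \<in> {0..R}" for t
        using le[OF that] elim that by (force simp: s_def dist_real_def abs_less_iff)
      have "bounded (poly s ` {0..R})"
        by (intro compact_imp_bounded compact_continuous_image continuous_intros) simp
      then obtain K where K: "\<And>t. t \<in> {0..R} \<Longrightarrow> \<bar>poly s t\<bar> \<le> K"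
        unfolding bounded_iff by (metis imageI real_norm_def)
      have sp: "t \<in> {0..R}" if "complex_of_real t \<in> spectrum T" for t
        using spectrum_positive[OF T that] R by simp
      have "0 \<le> Re (cinner (op_poly s T x) x)"
        by (rule op_poly_nonneg[OF sa, of s "max 0 K"])
          (use s0 K sp in \<open>fastforce simp: abs_le_iff le_max_iff_disj\<close>)+
      then show ?case
        by (simp add: s_def op_poly_diff op_poly_add op_poly_const blinfun.diff_left cinner.add_left
            cinner.diff_left cinner.scaleR_left)
    qed
  qed simp
  show ?thesis
  proof (rule tendsto_lowerbound)
    show "((\<lambda>\<delta>. Re (cinner (cfc f T x) x) + (\<eta> + \<delta>) * (norm x)\<^sup>2)
        \<longlongrightarrow> Re (cinner (cfc f T x) x) + \<eta> * (norm x)\<^sup>2) (at_right 0)"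
      by (auto intro!: tendsto_eq_intros)
    show "\<forall>\<^sub>F \<delta> in at_right 0. Re (cinner (op_poly p T x) x)
        \<le> Re (cinner (cfc f T x) x) + (\<eta> + \<delta>) * (norm x)\<^sup>2"
      using step by (auto simp: eventually_at_filter)
  qed simp
qed

text \<open>Self-adjointness survives the limit of polynomials in \<open>T\<close>; positivity is
  the comparison \<open>op_poly_le_cfc\<close> with the zero polynomial.\<close>

lemma positive_cfc:
  assumes T: "positive_op T" and f: "continuous_on {0..} f" and nn: "\<And>t. t \<ge> 0 \<Longrightarrow> f t \<ge> 0"
  shows "positive_op (cfc f T)"
proof -
  have sa: "selfadjoint T"
    using T by (simp add: positive_op_def)
  have "continuous_on {0..norm T} f"
    by (rule continuous_on_subset[OF f]) auto
  then obtain q where q: "uniform_limit {0..norm T} (\<lambda>m. poly (q m)) f sequentially"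
    using Weierstrass_poly_limit[OF compact_Icc] by blast
  note lim = cfc_limit_positive[OF T order_refl q]
  have "cinner (cfc f T x) y = cinner x (cfc f T y)" for x y
  proof (rule LIMSEQ_unique)
    show "(\<lambda>m. cinner (op_poly (q m) T x) y) \<longlonglongrightarrow> cinner (cfc f T x) y"
      by (intro tendsto_intros cinner.tendsto blinfun.tendsto lim)
    show "(\<lambda>m. cinner (op_poly (q m) T x) y) \<longlonglongrightarrow> cinner x (cfc f T y)"
      unfolding selfadjointD[OF selfadjoint_op_poly[OF sa]]
      by (intro tendsto_intros cinner.tendsto blinfun.tendsto lim)
  qed
  moreover have "0 \<le> Re (cinner (cfc f T x) x)" for x
    using op_poly_le_cfc[OF T f order_refl, of 0 0 x] nn by (simp add: cinner.zero_left)
  ultimately show ?thesis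
    by (simp add: positive_op_def selfadjoint_def)
qed

section \<open>The mixed Schwarz inequality\<close>

lemma uniform_limit_mult_compact:
  fixes l m :: "real \<Rightarrow> real"
  assumes "compact S" "continuous_on S l" "continuous_on S m"
    "uniform_limit S f l F" "uniform_limit S g m F"
  shows "uniform_limit S (\<lambda>a b. f a b * g a b) (\<lambda>b. l b * m b) F"
  using assms by (intro uniform_lim_mult compact_imp_bounded compact_continuous_image)

section \<open>The absolute value of an operator\<close>

lemma positive_adj_compose:
  assumes T: "complex_linear T"
  shows "positive_op (adj T o\<^sub>L T)"
proof -
  have "cinner (adj T (T x)) y = cinner (T x) (T y)" for x y
    by (rule cinner_adj[OF T])
  then show ?thesis
    by (simp add: positive_op_def selfadjoint_def flip: adj_cinner[OF T])
qed

lemma positive_op_abs: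
  assumes T: "complex_linear T"
  shows "positive_op (op_abs T)"
  unfolding op_abs_def
  by (intro positive_cfc positive_adj_compose T continuous_intros) simp

text \<open>If \<open>q m\<close> tends to \<open>sqrt\<close> uniformly, its square tends to the
  identity function. Hence \<open>q m (P)\<close> applied twice tends both to \<open>|T|\<close>
  applied twice and to \<open>P\<close>.\<close>

lemma op_abs_op_abs:
  assumes T: "complex_linear T"
  shows "op_abs T (op_abs T x) = adj T (T x)"
proof -
  define P where "P = adj T o\<^sub>L T"
  have P: "positive_op P"
    unfolding P_def by (rule positive_adj_compose[OF T])
  define I where "I = {0..norm P}"
  have I: "compact I"
    by (simp add: I_def)
  obtain q where q: "uniform_limit I (\<lambda>m. poly (q m)) sqrt sequentially"
    using Weierstrass_poly_limit[OF I] continuous_on_real_sqrt[OF continuous_on_id] by blast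
  have "uniform_limit I (\<lambda>m t. poly (q m) t * poly (q m) t) (\<lambda>t. sqrt t * sqrt t) sequentially"
    by (intro uniform_limit_mult_compact I q continuous_intros)
  then have q2: "uniform_limit I (\<lambda>m. poly (q m * q m)) (\<lambda>t. t) sequentially"
    by (rule uniform_limit_cong'[THEN iffD1, rotated -1]) (auto simp: I_def)
  have lim_sqrt: "(\<lambda>m. op_poly (q m) P) \<longlonglongrightarrow> op_abs T"
    unfolding op_abs_def P_def[symmetric]
    by (rule cfc_limit_positive[OF P order_refl q[unfolded I_def]])
  have "(\<lambda>m. op_poly (q m * q m) P) \<longlonglongrightarrow> cfc (\<lambda>t. t) P"
    by (rule cfc_limit_positive[OF P order_refl q2[unfolded I_def]])
  \<comment> \<open>The constant sequence \<open>[:0, 1:]\<close> identifies the functional calculus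
    of the identity function with \<open>P\<close> itself.\<close>
  moreover have "(\<lambda>m. op_poly [:0, 1:] P) \<longlonglongrightarrow> cfc (\<lambda>t. t) P"
  proof (rule cfc_limit_positive[OF P order_refl])
    have "poly [:0, 1:] = (\<lambda>t :: real. t)"
      by (simp add: fun_eq_iff)
    then show "uniform_limit {0..norm P} (\<lambda>m. poly [:0, 1:]) (\<lambda>t. t) sequentially"
      by (simp only: uniform_limit_const)
  qed
  then have "cfc (\<lambda>t. t) P = op_poly [:0, 1:] P"
    by (rule LIMSEQ_unique[OF _ tendsto_const])
  ultimately have "(\<lambda>m. op_poly (q m * q m) P) \<longlonglongrightarrow> op_poly [:0, 1:] P"
    by simp
  then have "(\<lambda>m. op_poly (q m * q m) P x) \<longlonglongrightarrow> op_poly [:0, 1:] P x"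
    by (intro blinfun.tendsto tendsto_const)
  then have "(\<lambda>m. op_poly (q m) P (op_poly (q m) P x)) \<longlonglongrightarrow> P x"
    by (simp add: op_poly_mult op_poly_X)
  moreover have "(\<lambda>m. op_poly (q m) P (op_poly (q m) P x)) \<longlonglongrightarrow> op_abs T (op_abs T x)"
    by (intro blinfun.tendsto tendsto_const lim_sqrt)
  ultimately have "op_abs T (op_abs T x) = P x"
    by (rule LIMSEQ_unique[symmetric])
  then show ?thesis
    by (simp add: P_def)
qed

text \<open>From \<open>T (adj T T) = (T adj T) T\<close> the same holds for polynomials, and in the
  limit for the square roots, using one approximating sequence on an interval that covers both
  spectra.\<close>

lemma op_abs_intertwine:
  assumes T: "complex_linear T"
  shows "T (op_abs T x) = op_abs (adj T) (T x)"
proof -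
  define P where "P = adj T o\<^sub>L T"
  define Q where "Q = T o\<^sub>L adj T"
  have absQ: "op_abs (adj T) = cfc sqrt Q"
    by (simp add: op_abs_def Q_def adj_adj[OF T])
  have P: "positive_op P"
    unfolding P_def by (rule positive_adj_compose[OF T])
  have Q: "positive_op Q"
    unfolding Q_def using positive_adj_compose[OF complex_linear_adj[OF T]] by (simp add: adj_adj[OF T])
  define R where "R = max (norm P) (norm Q)"
  have sq: "continuous_on A sqrt" for A
    by (intro continuous_intros)
  obtain q where q: "uniform_limit {0..R} (\<lambda>m. poly (q m)) sqrt sequentially"
    using Weierstrass_poly_limit[OF compact_Icc sq] by blast
  have R: "norm P \<le> R" "norm Q \<le> R"
    by (simp_all add: R_def)
  have limP: "(\<lambda>m. op_poly (q m) P) \<longlonglongrightarrow> op_abs T"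
    unfolding op_abs_def P_def[symmetric] by (rule cfc_limit_positive[OF P R(1) q])
  have limQ: "(\<lambda>m. op_poly (q m) Q) \<longlonglongrightarrow> op_abs (adj T)"
    unfolding absQ by (rule cfc_limit_positive[OF Q R(2) q])
  have eq: "T (op_poly (q m) P x) = op_poly (q m) Q (T x)" for m
    by (rule op_poly_intertwine) (simp add: P_def Q_def)
  show ?thesis
  proof (rule LIMSEQ_unique)
    show "(\<lambda>m. T (op_poly (q m) P x)) \<longlonglongrightarrow> T (op_abs T x)"
      by (intro blinfun.tendsto tendsto_const limP)
    show "(\<lambda>m. T (op_poly (q m) P x)) \<longlonglongrightarrow> op_abs (adj T) (T x)"
      unfolding eq by (intro blinfun.tendsto tendsto_const limQ)
  qed
qed

text \<open>Since \<open>f\<close> may vanish, \<open>p\<close> approximates \<open>f + \<epsilon>\<close> and \<open>q\<close> approximates \<open>1 / (f + \<epsilon>)\<close>;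
  then \<open>t q(t) \<approx> f(t) g(t) / (f(t) + \<epsilon>) \<le> g(t)\<close>.\<close>

lemma factorization_poly_approx:
  fixes f g :: "real \<Rightarrow> real"
  assumes f: "continuous_on {0..} f"
    and f0: "\<And>t. t \<ge> 0 \<Longrightarrow> f t \<ge> 0" and g0: "\<And>t. t \<ge> 0 \<Longrightarrow> g t \<ge> 0"
    and fg: "\<And>t. t \<ge> 0 \<Longrightarrow> f t * g t = t" and \<eta>: "\<eta> > 0"
  shows "\<exists>p q. \<forall>t\<in>{0..R}. (poly p t)\<^sup>2 \<le> (f t)\<^sup>2 + \<eta> \<and> (t * poly q t)\<^sup>2 \<le> (g t)\<^sup>2 + \<eta>
    \<and> \<bar>1 - poly p t * poly q t\<bar> \<le> \<eta>"
proof -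
  define I where "I = {0..R}"
  have I: "compact I"
    by (simp add: I_def)
  have fI: "continuous_on I f"
    by (rule continuous_on_subset[OF f]) (auto simp: I_def)
  have "bounded (f ` I)"
    by (intro compact_imp_bounded compact_continuous_image fI I)
  then obtain M where M: "M > 0" "\<And>t. t \<in> I \<Longrightarrow> f t \<le> M"
    unfolding bounded_pos by (metis abs_le_iff imageI real_norm_def)
  \<comment> \<open>Chosen so that \<open>(f + \<epsilon>)^2\<close> exceeds \<open>f^2\<close> by
    at most \<open>\<eta> / 2\<close> when \<open>f <= M\<close>; the other half of
    \<open>\<eta>\<close> is left for the error of the polynomial. The cap at 1 gives
    \<open>\<epsilon>^2 <= \<epsilon>\<close>.\<close>
  define \<epsilon> where "\<epsilon> = min 1 (\<eta> / (2 * (2 * M + 1)))"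
  have \<epsilon>: "\<epsilon> > 0" "2 * \<epsilon> * M + \<epsilon>\<^sup>2 \<le> \<eta> / 2"
  proof -
    show pos: "\<epsilon> > 0"
      using M(1) \<eta> by (simp add: \<epsilon>_def)
    have "\<epsilon> \<le> 1"
      by (simp add: \<epsilon>_def)
    then have "\<epsilon>\<^sup>2 \<le> \<epsilon>"
      using pos by (simp add: power2_eq_square mult_left_le)
    then have "2 * \<epsilon> * M + \<epsilon>\<^sup>2 \<le> \<epsilon> * (2 * M + 1)"
      by (simp add: algebra_simps)
    also have "\<dots> \<le> \<eta> / (2 * (2 * M + 1)) * (2 * M + 1)"
      using M(1) by (intro mult_right_mono) (simp_all add: \<epsilon>_def)
    also have "\<dots> = \<eta> / 2"
      using M(1) by (simp add: divide_simps)
    finally show "2 * \<epsilon> * M + \<epsilon>\<^sup>2 \<le> \<eta> / 2" .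
  qed
  define h where "h t = f t + \<epsilon>" for t
  have h: "h t > 0" if "t \<in> I" for t
    using f0[of t] that \<epsilon>(1) by (simp add: h_def I_def)
  have ch: "continuous_on I h" "continuous_on I (\<lambda>t. 1 / h t)"
    using h fI by (auto simp: h_def intro!: continuous_intros dest!: less_imp_neq[THEN not_sym])
  obtain p where p: "uniform_limit I (\<lambda>m. poly (p m)) h sequentially"
    using Weierstrass_poly_limit[OF I ch(1)] by blast
  obtain q where q: "uniform_limit I (\<lambda>m. poly (q m)) (\<lambda>t. 1 / h t) sequentially"
    using Weierstrass_poly_limit[OF I ch(2)] by blast
  have "uniform_limit I (\<lambda>m t. poly (p m) t * poly (p m) t) (\<lambda>t. h t * h t) sequentially"
    by (intro uniform_limit_mult_compact I ch p)
  then have 1: "\<forall>\<^sub>F m in sequentially. \<forall>t\<in>I. dist (poly (p m) t * poly (p m) t) (h t * h t) < \<eta> / 2"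
    by (rule uniform_limitD) (use \<eta> in simp)
  have tq: "uniform_limit I (\<lambda>m t. t * poly (q m) t) (\<lambda>t. t * (1 / h t)) sequentially"
    by (intro uniform_limit_mult_compact I ch q uniform_limit_const continuous_on_id)
  have "uniform_limit I (\<lambda>m t. (t * poly (q m) t) * (t * poly (q m) t))
      (\<lambda>t. (t * (1 / h t)) * (t * (1 / h t))) sequentially"
    by (rule uniform_limit_mult_compact[OF I _ _ tq tq]) (intro ch continuous_on_mult continuous_on_id)+
  then have 2: "\<forall>\<^sub>F m in sequentially. \<forall>t\<in>I.
      dist ((t * poly (q m) t) * (t * poly (q m) t)) ((t * (1 / h t)) * (t * (1 / h t))) < \<eta>"
    by (rule uniform_limitD) (use \<eta> in simp)
  have "uniform_limit I (\<lambda>m t. poly (p m) t * poly (q m) t) (\<lambda>t. h t * (1 / h t)) sequentially"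
    by (intro uniform_limit_mult_compact I ch p q)
  then have 3: "\<forall>\<^sub>F m in sequentially. \<forall>t\<in>I. dist (poly (p m) t * poly (q m) t) (h t * (1 / h t)) < \<eta>"
    by (rule uniform_limitD) (use \<eta> in simp)
  obtain m where m: "\<forall>t\<in>I. dist (poly (p m) t * poly (p m) t) (h t * h t) < \<eta> / 2"
    "\<forall>t\<in>I. dist ((t * poly (q m) t) * (t * poly (q m) t)) ((t * (1 / h t)) * (t * (1 / h t))) < \<eta>"
    "\<forall>t\<in>I. dist (poly (p m) t * poly (q m) t) (h t * (1 / h t)) < \<eta>"
    using eventually_happens'[OF sequentially_bot eventually_conj[OF 1 eventually_conj[OF 2 3]]] by blast
  have "(poly (p m) t)\<^sup>2 \<le> (f t)\<^sup>2 + \<eta> \<and> (t * poly (q m) t)\<^sup>2 \<le> (g t)\<^sup>2 + \<eta>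
    \<and> \<bar>1 - poly (p m) t * poly (q m) t\<bar> \<le> \<eta>" if t: "t \<in> I" for t
  proof (intro conjI)
    have t0: "t \<ge> 0"
      using t by (simp add: I_def)
    have "\<epsilon> * f t \<le> \<epsilon> * M"
      using M(2)[OF t] \<epsilon>(1) by simp
    then have "h t * h t \<le> (f t)\<^sup>2 + \<eta> / 2"
      using \<epsilon>(2) by (simp add: h_def algebra_simps power2_eq_square)
    moreover have "\<bar>poly (p m) t * poly (p m) t - h t * h t\<bar> < \<eta> / 2"
      using m(1) t by (simp only: dist_real_def)
    ultimately show "(poly (p m) t)\<^sup>2 \<le> (f t)\<^sup>2 + \<eta>"
      unfolding power2_eq_square by linarith
    have "t * (1 / h t) = f t * g t / h t"
      by (simp add: fg[OF t0])
    also have "\<dots> \<le> g t"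
      using h[OF t] g0[OF t0] \<epsilon>(1) by (simp add: divide_le_eq h_def algebra_simps)
    finally have "(t * (1 / h t)) * (t * (1 / h t)) \<le> (g t)\<^sup>2"
      using h[OF t] t0 unfolding power2_eq_square by (intro mult_mono) (simp_all add: g0)
    moreover have "\<bar>(t * poly (q m) t) * (t * poly (q m) t) - (t * (1 / h t)) * (t * (1 / h t))\<bar> < \<eta>"
      using m(2) t by (simp only: dist_real_def)
    ultimately show "(t * poly (q m) t)\<^sup>2 \<le> (g t)\<^sup>2 + \<eta>"
      unfolding power2_eq_square by linarith
    have "\<bar>poly (p m) t * poly (q m) t - h t * (1 / h t)\<bar> < \<eta>"
      using m(3) t by (simp only: dist_real_def)
    then show "\<bar>1 - poly (p m) t * poly (q m) t\<bar> \<le> \<eta>"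
      using h[OF t] by (simp add: abs_minus_commute)
  qed
  then show ?thesis
    unfolding I_def by blast
qed

text \<open>Take \<open>p\<close> near \<open>f\<close> and \<open>q\<close> near
  \<open>1/f\<close>, and put \<open>B = |T|\<close>, \<open>C = |adj T|\<close>,
  \<open>u = p(B) x\<close>, \<open>w = q(C) y\<close>. Then \<open>x\<close> is close to
  \<open>q(B) u\<close>, and intertwining gives \<open><T q(B) u, y> = <u, adj T w>\<close>.
  Cauchy-Schwarz finishes, since \<open>|u|^2\<close> and \<open>|adj T w|^2\<close> are at most the
  two forms up to a multiple of \<open>\<eta>\<close>.\<close>

lemma mixed_Schwarz:
  fixes T :: "'a::complex_hilbert \<Rightarrow>\<^sub>L 'a" and f g :: "real \<Rightarrow> real"
  assumes T: "complex_linear T"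
    and f: "continuous_on {0..} f" and g: "continuous_on {0..} g"
    and f0: "\<And>t. t \<ge> 0 \<Longrightarrow> f t \<ge> 0" and g0: "\<And>t. t \<ge> 0 \<Longrightarrow> g t \<ge> 0"
    and fg: "\<And>t. t \<ge> 0 \<Longrightarrow> f t * g t = t"
  shows "cmod (cinner (T x) y) \<le>
    sqrt (Re (cinner (cfc (\<lambda>t. (f t)\<^sup>2) (op_abs T) x) x)) *
    sqrt (Re (cinner (cfc (\<lambda>t. (g t)\<^sup>2) (op_abs (adj T)) y) y))" (is "_ \<le> sqrt ?F * sqrt ?G")
proof -
  define B where "B = op_abs T"
  define C where "C = op_abs (adj T)"
  have B: "positive_op B" and C: "positive_op C"
    unfolding B_def C_def by (intro positive_op_abs complex_linear_adj T)+
  have saB: "selfadjoint B" and saC: "selfadjoint C"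
    using B C by (simp_all add: positive_op_def)
  define R where "R = max (norm B) (norm C)"
  have R: "norm B \<le> R" "norm C \<le> R"
    by (simp_all add: R_def)
  have cf: "continuous_on {0..} (\<lambda>t. (f t)\<^sup>2)" and cg: "continuous_on {0..} (\<lambda>t. (g t)\<^sup>2)"
    by (intro continuous_intros f g)+
  have approx: "cmod (cinner (T x) y) \<le> norm T * (\<eta> * norm x) * norm y
      + sqrt (?F + \<eta> * (norm x)\<^sup>2) * sqrt (?G + \<eta> * (norm y)\<^sup>2)" if \<eta>: "\<eta> > 0" for \<eta>
  proof -
    obtain p q where pq: "\<And>t. t \<in> {0..R} \<Longrightarrow> (poly p t)\<^sup>2 \<le> (f t)\<^sup>2 + \<eta>"
      "\<And>t. t \<in> {0..R} \<Longrightarrow> (t * poly q t)\<^sup>2 \<le> (g t)\<^sup>2 + \<eta>"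
      "\<And>t. t \<in> {0..R} \<Longrightarrow> \<bar>1 - poly p t * poly q t\<bar> \<le> \<eta>"
      using factorization_poly_approx[OF f f0 g0 fg \<eta>, of R] by blast
    define u where "u = op_poly p B x"
    define w where "w = op_poly q C y"
    \<comment> \<open>The replacement of \<open>x\<close> by \<open>q(B) u\<close> costs at most
      \<open>\<eta> |x|\<close>, because \<open>1 - q p\<close> is at most \<open>\<eta>\<close> in
      modulus on the spectrum of \<open>B\<close>.\<close>
    have "norm (op_poly ([:1:] - q * p) B) \<le> \<eta>"
    proof (rule norm_op_poly_le[OF saB])
      show "\<bar>poly ([:1:] - q * p) t\<bar> \<le> \<eta>" if "complex_of_real t \<in> spectrum B" for t
        using pq(3)[of t] spectrum_positive[OF B that] R(1) by (simp add: mult.commute)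
    qed (use \<eta> in simp)
    then have "norm (op_poly ([:1:] - q * p) B x) \<le> \<eta> * norm x"
      by (meson norm_blinfun order_trans mult_right_mono norm_ge_zero)
    moreover have "op_poly ([:1:] - q * p) B x = x - op_poly q B u"
      by (simp add: op_poly_diff blinfun.diff_left op_poly_const op_poly_mult u_def)
    ultimately have "norm (T (x - op_poly q B u)) \<le> norm T * (\<eta> * norm x)"
      by (metis norm_blinfun order_trans mult_left_mono norm_ge_zero)
    then have 1: "cmod (cinner (T (x - op_poly q B u)) y) \<le> norm T * (\<eta> * norm x) * norm y"
      by (meson Cauchy_Schwarz_cinner order_trans mult_right_mono norm_ge_zero)
    have "T (op_poly q B u) = op_poly q C (T u)"
      by (rule op_poly_intertwine) (simp add: B_def C_def op_abs_intertwine[OF T])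
    then have "cinner (T (op_poly q B u)) y = cinner u (adj T w)"
      by (simp add: w_def selfadjointD[OF selfadjoint_op_poly[OF saC]] adj_cinner[OF T])
    then have 2: "cmod (cinner (T (op_poly q B u)) y) \<le> norm u * norm (adj T w)"
      by (simp add: Cauchy_Schwarz_cinner)
    have "(norm u)\<^sup>2 = Re (cinner (op_poly (p * p) B x) x)"
      unfolding Re_cinner_same[symmetric]
      by (simp add: u_def op_poly_mult selfadjointD[OF selfadjoint_op_poly[OF saB]] del: Re_cinner_same)
    also have "\<dots> \<le> ?F + \<eta> * (norm x)\<^sup>2"
      unfolding B_def[symmetric]
      by (rule op_poly_le_cfc[OF B cf R(1)]) (use pq(1) in \<open>simp add: power2_eq_square\<close>)
    finally have 3: "norm u \<le> sqrt (?F + \<eta> * (norm x)\<^sup>2)"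
      by (rule real_le_rsqrt)
    \<comment> \<open>Writing \<open>T adj T\<close> as \<open>C^2\<close> turns
      \<open>|adj T w|^2\<close> into the form at \<open>y\<close> of the polynomial
      \<open>(t q(t))^2\<close> in \<open>C\<close>, which is compared with
      \<open>g^2\<close>.\<close>
    have CC: "C (C z) = T (adj T z)" for z
      unfolding C_def using op_abs_op_abs[OF complex_linear_adj[OF T]] by (simp add: adj_adj[OF T])
    have "(norm (adj T w))\<^sup>2 = Re (cinner (T (adj T w)) w)"
      by (simp add: adj_cinner[OF T])
    also have "\<dots> = Re (cinner (op_poly (q * ([:0, 1:] * ([:0, 1:] * q))) C y) y)"
      unfolding CC[symmetric]
      by (simp only: w_def op_poly_mult op_poly_X selfadjointD[OF selfadjoint_op_poly[OF saC]])
    also have "\<dots> \<le> ?G + \<eta> * (norm y)\<^sup>2"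
      unfolding C_def[symmetric]
      by (rule op_poly_le_cfc[OF C cg R(2)]) (use pq(2) in \<open>simp add: power2_eq_square mult_ac\<close>)
    finally have 4: "norm (adj T w) \<le> sqrt (?G + \<eta> * (norm y)\<^sup>2)"
      by (rule real_le_rsqrt)
    have "cinner (T x) y = cinner (T (x - op_poly q B u)) y + cinner (T (op_poly q B u)) y"
      by (simp add: blinfun.diff_right cinner.diff_left)
    then have "cmod (cinner (T x) y) \<le> norm T * (\<eta> * norm x) * norm y + norm u * norm (adj T w)"
      using 1 2 norm_triangle_ineq[of "cinner (T (x - op_poly q B u)) y"] by (smt (verit))
    also have "norm u * norm (adj T w) \<le> sqrt (?F + \<eta> * (norm x)\<^sup>2) * sqrt (?G + \<eta> * (norm y)\<^sup>2)"
      using 3 4 order_trans[OF norm_ge_zero 3] by (intro mult_mono) auto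
    finally show ?thesis
      by simp
  qed
  show ?thesis
  proof (rule tendsto_lowerbound)
    show "((\<lambda>\<eta>. norm T * (\<eta> * norm x) * norm y
      + sqrt (?F + \<eta> * (norm x)\<^sup>2) * sqrt (?G + \<eta> * (norm y)\<^sup>2)) \<longlongrightarrow> sqrt ?F * sqrt ?G) (at_right 0)"
      by (auto intro!: tendsto_eq_intros)
    show "\<forall>\<^sub>F \<eta> in at_right 0. cmod (cinner (T x) y) \<le> norm T * (\<eta> * norm x) * norm y
      + sqrt (?F + \<eta> * (norm x)\<^sup>2) * sqrt (?G + \<eta> * (norm y)\<^sup>2)"
      using approx by (auto simp: eventually_at_filter)
  qed simp
qed

section \<open>Berezin bounds\<close>

text \<open>At a zero vector, division by 0 makes \<open>normalized\<close> zero, so the bound holds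
  for every family \<open>k\<close>.\<close>

lemma norm_normalized_le: "norm (normalized k \<omega>) \<le> 1"
  by (cases "k \<omega> = 0") (simp_all add: normalized_def)

text \<open>Supplies the boundedness without which the real suprema defining the Berezin quantities
  need not be upper bounds.\<close>

lemma cmod_cinner_normalized_le:
  "cmod (cinner (blinfun_apply S (normalized k \<omega>)) (normalized k \<nu>)) \<le> norm S"
proof -
  have "cmod (cinner (S (normalized k \<omega>)) (normalized k \<nu>))
      \<le> norm S * norm (normalized k \<omega>) * norm (normalized k \<nu>)"
    by (meson Cauchy_Schwarz_cinner norm_blinfun order_trans mult_right_mono norm_ge_zero)
  also have "\<dots> \<le> norm S * 1 * 1"
    by (intro mult_mono norm_normalized_le) auto
  finally show ?thesis
    by simp
qed

lemma berezin_number_upper: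
  "cmod (cinner (blinfun_apply S (normalized k \<omega>)) (normalized k \<omega>)) \<le> berezin_number k S"
proof -
  have "bdd_above (range (\<lambda>\<omega>. cmod (cinner (S (normalized k \<omega>)) (normalized k \<omega>))))"
    by (rule bdd_aboveI2[where M = "norm S"]) (rule cmod_cinner_normalized_le)
  from cSUP_upper[OF UNIV_I this] show ?thesis
    by (simp add: berezin_number_def)
qed

lemma berezin_norm_upper:
  "cmod (cinner (blinfun_apply S (normalized k \<omega>)) (normalized k \<nu>)) \<le> berezin_norm k S"
proof -
  let ?h = "\<lambda>(\<omega>, \<nu>). cmod (cinner (S (normalized k \<omega>)) (normalized k \<nu>))"
  have "bdd_above (range ?h)"
    by (rule bdd_aboveI2[where M = "norm S"]) (auto simp: cmod_cinner_normalized_le)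
  from cSUP_upper[OF UNIV_I this, of "(\<omega>, \<nu>)"] show ?thesis
    by (simp add: berezin_norm_def)
qed

lemma cinner_blinfun_scaleR:
  "cinner (blinfun_apply S (r *\<^sub>R x)) (r *\<^sub>R x) = r\<^sup>2 *\<^sub>R cinner (blinfun_apply S x) x"
  unfolding blinfun.scaleR_right cinner_scaleR_left cinner_scaleR_right
  by (simp add: power2_eq_square)

lemma numerical_radius_upper:
  fixes M :: "complex ^ 'n ^ 'n::finite"
  assumes "norm x = 1"
  shows "cmod (cinner (M *v x) x) \<le> numerical_radius M"
  unfolding numerical_radius_def
proof (rule cSup_upper)
  show "bdd_above {cmod (cinner (M *v x) x) |x. norm x = 1}"
  proof (rule bdd_aboveI, clarify)
    fix y :: "complex ^ 'n"
    assume y: "norm y = 1"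
    have comp: "cmod (y $ i) \<le> 1" for i
      using Finite_Cartesian_Product.norm_nth_le[of y i] y by simp
    have "cmod (cinner (M *v y) y) \<le> norm (M *v y) * norm y"
      by (rule Cauchy_Schwarz_cinner)
    also have "\<dots> \<le> (\<Sum>i\<in>UNIV. cmod ((M *v y) $ i))"
      unfolding y mult_1_right norm_vec_def[of "M *v y"] by (rule L2_set_le_sum) simp
    also have "\<dots> \<le> (\<Sum>i\<in>UNIV. \<Sum>j\<in>UNIV. cmod (M $ i $ j))"
      unfolding matrix_vector_mult_def
      by (auto intro!: sum_mono order_trans[OF norm_sum] mult_left_le comp simp: norm_mult)
    finally show "cmod (cinner (M *v y) y) \<le> (\<Sum>i\<in>UNIV. \<Sum>j\<in>UNIV. cmod (M $ i $ j))" .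
  qed
qed (use assms in blast)

text \<open>Cauchy-Schwarz for \<open>(sqrt a, sqrt d)\<close> and \<open>(sqrt b, sqrt c)\<close>;
  \<open>a\<close> and \<open>d\<close> are grouped because they will be forms at the same
  vector.\<close>

lemma sqrt_mult_add_sqrt_mult_le:
  assumes "a \<ge> 0" "b \<ge> 0" "c \<ge> 0" "d \<ge> 0"
  shows "sqrt a * sqrt b + sqrt c * sqrt d \<le> sqrt (a + d) * sqrt (c + b)"
proof -
  have "0 \<le> (sqrt a * sqrt c - sqrt b * sqrt d)\<^sup>2"
    by simp
  then have "(sqrt a * sqrt b + sqrt c * sqrt d)\<^sup>2 \<le> (a + d) * (c + b)"
    using assms by (simp add: power2_eq_square algebra_simps real_sqrt_mult_self)
  then show ?thesis
    unfolding real_sqrt_mult[symmetric] by (rule real_le_rsqrt)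
qed

theorem theorem2p7:
  fixes ev :: "'h::complex_hilbert \<Rightarrow> 'w \<Rightarrow> complex"
    and A :: "('h \<Rightarrow>\<^sub>L 'h) ^ 'n::{finite,linorder} ^ 'n::{finite,linorder}"
    and f g :: "real \<Rightarrow> real"
  assumes "rkhs ev"
    and "\<And>i j. complex_linear (A $ i $ j)"
    and "continuous_on {0..} f" and "continuous_on {0..} g"
    and "\<And>t. t \<ge> 0 \<Longrightarrow> f t \<ge> 0" and "\<And>t. t \<ge> 0 \<Longrightarrow> g t \<ge> 0"
    and "\<And>t. t \<ge> 0 \<Longrightarrow> f t * g t = t"
  shows "berezin_number (sum_kernel (repr_kernel ev)) (op_matrix A)
    \<le> numerical_radius (bound_matrix ev f g A)"
  unfolding berezin_number_def
proof (rule cSUP_least)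
  define k where "k = repr_kernel ev"
  have k0: "k \<omega> \<noteq> 0" for \<omega>
    using rkhs.kernel_nonzero[OF assms(1)] by (simp add: k_def)
  fix \<omega> :: "'w ^ 'n::{finite,linorder}"
  define v where "v = normalized (sum_kernel k) \<omega>"
  define \<tau> where "\<tau> i = norm (v $ i)" for i
  have "sum_kernel k \<omega> $ i \<noteq> 0" for i
    by (simp add: sum_kernel_def k0)
  then have sk0: "sum_kernel k \<omega> \<noteq> 0"
    by (metis zero_index)
  then have "norm v = 1"
    by (simp add: v_def normalized_def)
  \<comment> \<open>Each component is a multiple of a normalized kernel of the original space, so
    the Berezin quantities of the entries apply to it.\<close>
  have v: "v $ i = \<tau> i *\<^sub>R normalized k (\<omega> $ i)" for i
    using k0 by (simp add: \<tau>_def v_def normalized_def sum_kernel_def)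
  have \<tau>0: "\<tau> i \<ge> 0" for i
    by (simp add: \<tau>_def)
  define F where "F T = cfc (\<lambda>t. (f t)\<^sup>2) (op_abs T)" for T :: "'h \<Rightarrow>\<^sub>L 'h"
  define G where "G T = cfc (\<lambda>t. (g t)\<^sup>2) (op_abs (adj T))" for T :: "'h \<Rightarrow>\<^sub>L 'h"
  have F0: "0 \<le> Re (cinner (F (A $ i $ j) x) x)" and G0: "0 \<le> Re (cinner (G (A $ i $ j) x) x)" for i j x
  proof -
    have "positive_op (F (A $ i $ j))" "positive_op (G (A $ i $ j))"
      unfolding F_def G_def
      by (intro positive_cfc positive_op_abs complex_linear_adj assms continuous_intros; simp)+
    then show "0 \<le> Re (cinner (F (A $ i $ j) x) x)" "0 \<le> Re (cinner (G (A $ i $ j) x) x)"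
      by (simp_all add: positive_op_def)
  qed
  have FG: "cmod (cinner (blinfun_apply (A $ i $ j) x) y)
      \<le> sqrt (Re (cinner (F (A $ i $ j) x) x)) * sqrt (Re (cinner (G (A $ i $ j) y) y))" for i j x y
    unfolding F_def G_def by (rule mixed_Schwarz) (fact assms)+
  define m where "m i j = Re (bound_matrix ev f g A $ i $ j)" for i j
  have M: "bound_matrix ev f g A $ i $ j = complex_of_real (m i j)" for i j
    by (simp add: m_def bound_matrix_def)
  define b where "b i j = cmod (cinner (blinfun_apply (A $ i $ j) (v $ j)) (v $ i))" for i j
  \<comment> \<open>The Berezin norm is used only at coinciding points; the factor
    \<open>\<tau> i\<close> enters twice.\<close>
  have norm_bound: "Re (cinner (blinfun_apply S (v $ i)) (v $ i)) \<le> berezin_norm k S * (\<tau> i)\<^sup>2" for S i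
  proof -
    have "Re (cinner (S (v $ i)) (v $ i))
        \<le> (\<tau> i)\<^sup>2 * cmod (cinner (S (normalized k (\<omega> $ i))) (normalized k (\<omega> $ i)))"
      by (simp add: v cinner_blinfun_scaleR mult_left_mono complex_Re_le_cmod)
    also have "\<dots> \<le> (\<tau> i)\<^sup>2 * berezin_norm k S"
      by (intro mult_left_mono berezin_norm_upper) simp
    finally show ?thesis
      by (simp add: mult.commute)
  qed
  have diag: "b i i \<le> m i i * \<tau> i * \<tau> i" for i
  proof -
    have "b i i = (\<tau> i)\<^sup>2 * cmod (cinner (blinfun_apply (A $ i $ i) (normalized k (\<omega> $ i))) (normalized k (\<omega> $ i)))"
      by (simp add: b_def v cinner_blinfun_scaleR)
    also have "\<dots> \<le> (\<tau> i)\<^sup>2 * berezin_number k (A $ i $ i)"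
      by (intro mult_left_mono berezin_number_upper) simp
    finally show ?thesis
      by (simp add: m_def bound_matrix_def k_def power2_eq_square mult_ac)
  qed
  have off: "b i j + b j i \<le> m i j * \<tau> i * \<tau> j" if "i < j" for i j
  proof -
    let ?X = "berezin_norm k (F (A $ i $ j) + G (A $ j $ i))"
    let ?Y = "berezin_norm k (F (A $ j $ i) + G (A $ i $ j))"
    have "b i j + b j i \<le>
        sqrt (Re (cinner (F (A $ i $ j) (v $ j)) (v $ j))) * sqrt (Re (cinner (G (A $ i $ j) (v $ i)) (v $ i)))
        + sqrt (Re (cinner (F (A $ j $ i) (v $ i)) (v $ i))) * sqrt (Re (cinner (G (A $ j $ i) (v $ j)) (v $ j)))"
      unfolding b_def by (intro add_mono FG)
    \<comment> \<open>The regrouping collects both terms at \<open>v $ j\<close> in one factor and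
      both at \<open>v $ i\<close> in the other, which produces the two operator sums in the bound
      matrix.\<close>
    also have "\<dots> \<le> sqrt (Re (cinner ((F (A $ i $ j) + G (A $ j $ i)) (v $ j)) (v $ j)))
        * sqrt (Re (cinner ((F (A $ j $ i) + G (A $ i $ j)) (v $ i)) (v $ i)))"
      unfolding blinfun.add_left cinner.add_left plus_complex.sel
      by (intro sqrt_mult_add_sqrt_mult_le F0 G0)
    also have "\<dots> \<le> sqrt (?X * (\<tau> j)\<^sup>2) * sqrt (?Y * (\<tau> i)\<^sup>2)"
      by (intro mult_mono real_sqrt_le_mono norm_bound)
        (simp_all add: blinfun.add_left cinner.add_left F0 G0 real_sqrt_ge_zero order_trans[OF _ norm_bound])
    also have "\<dots> = m i j * \<tau> i * \<tau> j"
      using that less_imp_neq[OF that] \<tau>0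
      by (simp add: real_sqrt_mult m_def bound_matrix_def k_def F_def G_def)
    finally show ?thesis .
  qed
  \<comment> \<open>The bound matrix vanishes below the diagonal, so \<open>b i j\<close> alone need
    not be dominated by its entry; only the sum over a transposed pair is. Adding over all ordered
    pairs counts each double sum twice.\<close>
  have pair: "b i j + b j i \<le> m i j * \<tau> i * \<tau> j + m j i * \<tau> j * \<tau> i" for i j
  proof (cases i j rule: linorder_cases)
    case less
    moreover have "m j i = 0"
      using less by (auto simp: m_def bound_matrix_def)
    ultimately show ?thesis
      using off[of i j] by simp
  next
    case greater
    moreover have "m i j = 0"
      using greater by (auto simp: m_def bound_matrix_def)
    ultimately show ?thesis
      using off[of j i] by simp
  next
    case equal
    then show ?thesis
      using add_mono[OF diag[of i] diag[of i]] by simp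
  qed
  have sum_le: "(\<Sum>i\<in>UNIV. \<Sum>j\<in>UNIV. b i j) \<le> (\<Sum>i\<in>UNIV. \<Sum>j\<in>UNIV. m i j * \<tau> i * \<tau> j)"
  proof -
    have "2 * (\<Sum>i\<in>UNIV. \<Sum>j\<in>UNIV. b i j) = (\<Sum>i\<in>UNIV. \<Sum>j\<in>UNIV. b i j + b j i)"
      using sum.swap[of b UNIV UNIV] by (simp add: sum.distrib)
    also have "\<dots> \<le> (\<Sum>i\<in>UNIV. \<Sum>j\<in>UNIV. m i j * \<tau> i * \<tau> j + m j i * \<tau> j * \<tau> i)"
      by (intro sum_mono pair)
    also have "\<dots> = 2 * (\<Sum>i\<in>UNIV. \<Sum>j\<in>UNIV. m i j * \<tau> i * \<tau> j)"
      using sum.swap[of "\<lambda>i j. m i j * \<tau> i * \<tau> j" UNIV UNIV] by (simp add: sum.distrib)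
    finally show ?thesis
      by simp
  qed
  have "cmod (cinner (op_matrix A v) v) = cmod (\<Sum>i\<in>UNIV. \<Sum>j\<in>UNIV. cinner (blinfun_apply (A $ i $ j) (v $ j)) (v $ i))"
    by (simp add: cinner_vec_def op_matrix.rep_eq cinner.sum_left)
  also have "\<dots> \<le> (\<Sum>i\<in>UNIV. \<Sum>j\<in>UNIV. b i j)"
    unfolding b_def by (intro sum_norm_le norm_sum)
  also note sum_le
  also have "(\<Sum>i\<in>UNIV. \<Sum>j\<in>UNIV. m i j * \<tau> i * \<tau> j) \<le> numerical_radius (bound_matrix ev f g A)"
  proof -
    \<comment> \<open>The test vector for the numerical radius: \<open>\<tau>\<close> has the same
      Euclidean norm as \<open>v\<close>, namely 1.\<close>
    define x :: "complex ^ 'n::{finite,linorder}" where "x = (\<chi> i. complex_of_real (\<tau> i))"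
    have "norm x = norm v"
      by (simp add: x_def norm_vec_def \<tau>_def)
    with \<open>norm v = 1\<close> have x: "norm x = 1"
      by simp
    have "cinner (bound_matrix ev f g A *v x) x
        = complex_of_real (\<Sum>i\<in>UNIV. \<Sum>j\<in>UNIV. m i j * \<tau> i * \<tau> j)"
      by (simp add: cinner_vec_def matrix_vector_mult_def M x_def cinner_complex_def sum_distrib_left mult_ac)
    then have "\<bar>\<Sum>i\<in>UNIV. \<Sum>j\<in>UNIV. m i j * \<tau> i * \<tau> j\<bar> \<le> numerical_radius (bound_matrix ev f g A)"
      using numerical_radius_upper[OF x, of "bound_matrix ev f g A"] by (simp only: norm_of_real)
    then show ?thesis
      by linarith
  qed
  finally show "cmod (cinner (op_matrix A (normalized (sum_kernel (repr_kernel ev)) \<omega>))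
      (normalized (sum_kernel (repr_kernel ev)) \<omega>)) \<le> numerical_radius (bound_matrix ev f g A)"
    by (simp only: v_def k_def)
qed simp

end
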